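(* Let $m\ge 1$. For each odd $j$ there are real numbers $a_j(n)$ with $\lim_{n\to\infty}a_j(n)=\frac{\sqrt2}{j}$ such that the classical MDS embedding of $S^1_n$ into $\mathbb{R}^m$ lies, up to a rigid motion of $\mathbb{R}^m$, on the curve $\gamma_m\colon S^1\to\mathbb{R}^m$ (depending on $n$) defined by $$\gamma_m(\theta)=\bigl(a_1(n)\cos\theta,\ a_1(n)\sin\theta,\ a_3(n)\cos 3\theta,\ a_3(n)\sin 3\theta,\ a_5(n)\cos 5\theta,\ldots\bigr)\in\mathbb{R}^m$$ (the list being truncated to its first $m$ coordinates).
   Context: $S^1$ is the circle of circumference $2\pi$ with its geodesic (shortest arc length) metric, and $S^1_n$ is a set of $n$ evenly spaced points of $S^1$ with the restricted metric. Classical MDS: for an $n\times n$ distance matrix $\mathbf{D}=(d_{ij})$, let $\mathbf{A}=(-\tfrac12 d_{ij}^2)$ and $\mathbf{B}=\mathbf{H}\mathbf{A}\mathbf{H}$, where $\mathbf{H}=\mathbf{I}-n^{-1}\mathbf{1}\mathbf{1}^\top$. Assume that $\mathbf{B}$ has at least $m$ positive eigenvalues. Let $\mathbf{\Lambda}_m$ be the $m\times m$ diagonal matrix of the $m$ largest eigenvalues of $\mathbf{B}$ (with multiplicity) in descending order, and $\mathbf{\Gamma}_m$ the $n\times m$ matrix of corresponding orthonormal eigenvectors. The classical MDS embedding into $\mathbb{R}^m$ consists of the $n$ points of $\mathbb{R}^m$ given by the rows of $\mathbf{\Gamma}_m\mathbf{\Lambda}_m^{1/2}$. *)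

theory Defs
  imports
    Complex_Main
    "HOL-Computational_Algebra.Polynomial"
    "Jordan_Normal_Form.Char_Poly"
begin

text \<open>
  The space \<open>\<real>\<^sup>m\<close> is \<open>carrier_vec m\<close>. The circle of circumference \<open>2\<pi>\<close> is
  \<open>\<real> / 2\<pi>\<int>\<close>: its points are represented by angles. The arcs joining the points with
  angles \<open>s\<close> and \<open>t\<close> have lengths \<open>\<bar>s - t + 2\<pi>k\<bar>\<close> for integer \<open>k\<close>, and the geodesic
  distance is the least of these.
\<close>

definition circle_dist :: "real \<Rightarrow> real \<Rightarrow> real" where
  "circle_dist s t = (INF k::int. \<bar>s - t + 2 * pi * of_int k\<bar>)"

text \<open>
  \<open>p 0, \<dots>, p (n - 1)\<close> lists, in any order, \<open>n\<close> evenly spaced points of the circle;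
  \<open>c\<close> is the position of one of them.
\<close>

definition evenly_spaced :: "nat \<Rightarrow> (nat \<Rightarrow> real) \<Rightarrow> bool" where
  "evenly_spaced n p \<longleftrightarrow>
     (\<exists>c. bij_betw p {..<n} ((\<lambda>i. c + 2 * pi * real i / real n) ` {..<n}))"

definition circle_dist_mat :: "nat \<Rightarrow> (nat \<Rightarrow> real) \<Rightarrow> real mat" where
  "circle_dist_mat n p = mat n n (\<lambda>(i, j). circle_dist (p i) (p j))"

definition centering_mat :: "nat \<Rightarrow> real mat" where
  "centering_mat n = 1\<^sub>m n - (1 / real n) \<cdot>\<^sub>m mat n n (\<lambda>_. 1)"

definition mds_gram :: "real mat \<Rightarrow> real mat" where
  "mds_gram D =
     (let H = centering_mat (dim_row D); A = map_mat (\<lambda>d. - (1 / 2) * d\<^sup>2) D in H * A * H)"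

text \<open>
  Eigenvalues are counted with multiplicity as roots of the characteristic polynomial. For the
  symmetric matrices considered here all complex eigenvalues are real, and algebraic and
  geometric multiplicities agree.
\<close>

definition eigvals_desc :: "real mat \<Rightarrow> real list" where
  "eigvals_desc B = rev (sorted_list_of_multiset (proots (char_poly B)))"

definition num_pos_eigvals :: "real mat \<Rightarrow> nat" where
  "num_pos_eigvals B = size (filter_mset (\<lambda>e. e > 0) (proots (char_poly B)))"

text \<open>
  \<open>P\<close> is the set of points of a classical MDS embedding into \<open>\<real>\<^sup>m\<close> of the distance matrix
  \<open>D\<close>. This is a relation because the orthonormal eigenvectors (the columns of \<open>\<Gamma>\<close>) are not
  unique. It is meaningful only if \<open>mds_gram D\<close> has at least \<open>m\<close> positive eigenvalues.
\<close>

definition classical_mds_embedding :: "nat \<Rightarrow> real mat \<Rightarrow> real vec set \<Rightarrow> bool" where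
  "classical_mds_embedding m D P \<longleftrightarrow>
     (let B = mds_gram D; ev = eigvals_desc B in
        \<exists>\<Gamma> \<in> carrier_mat (dim_row D) m.
          transpose_mat \<Gamma> * \<Gamma> = 1\<^sub>m m \<and>
          (\<forall>i<m. eigenvector B (col \<Gamma> i) (ev ! i)) \<and>
          P = set (rows (\<Gamma> * mat_diag m (\<lambda>i. sqrt (ev ! i)))))"

definition euclid_dist :: "real vec \<Rightarrow> real vec \<Rightarrow> real" where
  "euclid_dist x y = sqrt ((x - y) \<bullet> (x - y))"

definition rigid_motion :: "nat \<Rightarrow> (real vec \<Rightarrow> real vec) \<Rightarrow> bool" where
  "rigid_motion m f \<longleftrightarrow>
     bij_betw f (carrier_vec m) (carrier_vec m) \<and>
     (\<forall>x \<in> carrier_vec m. \<forall>y \<in> carrier_vec m. euclid_dist (f x) (f y) = euclid_dist x y)"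

text \<open>
  Coordinates are indexed from \<open>0\<close>: for even \<open>i\<close>, coordinates \<open>i\<close> and \<open>i + 1\<close> are the cosine
  and the sine with frequency \<open>i + 1\<close>.
\<close>

definition gamma_curve :: "nat \<Rightarrow> (nat \<Rightarrow> real) \<Rightarrow> real \<Rightarrow> real vec" where
  "gamma_curve m a \<theta> =
     vec m (\<lambda>i. if even i then a (i + 1) * cos (real (i + 1) * \<theta>)
                else a i * sin (real i * \<theta>))"

end

theory Submission
  imports Defs "HOL-Real_Asymp.Real_Asymp"
begin

text \<open>
  Double centering acts as the identity on the nonconstant discrete Fourier modes of the points, and
  the squared distance matrix is circulant, so the Gram matrix is diagonalised by these modes. The
  eigenvalue of frequency \<open>l\<close> is negative or zero for even \<open>l \<le> n/2\<close>, and positive and strictly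
  decreasing along odd \<open>l \<le> n/2\<close>; frequencies \<open>l\<close> and \<open>n - l\<close> share it. Hence the sorted positive
  eigenvalues belong to the frequencies \<open>1, 1, 3, 3, 5, 5, \<dots>\<close>, with eigenspaces spanned by the cosine
  and sine of that frequency. Any two orthonormal eigenbases differ by an orthogonal matrix that
  commutes with the eigenvalue matrix, and this matrix is the rigid motion. If \<open>m\<close> is odd, the last
  eigenvector is a single vector of a two-dimensional eigenspace, hence a phase-shifted cosine; the
  shift is absorbed by reparametrising the whole curve.
\<close>

section \<open>Distances on the circle and their Fourier transform\<close>

text \<open>The squared number of steps between two of \<open>n\<close> positions that lie
  \<open>u\<close> apart. Without the factor \<open>2 * pi / n\<close> it is an integer, so its
  differences are exact.\<close>

definition sq_dist_mod :: "nat \<Rightarrow> int \<Rightarrow> int" where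
  "sq_dist_mod n u = (min (u mod int n) (int n - u mod int n))\<^sup>2"

text \<open>In units of the step \<open>2 * pi / n\<close> the arcs have lengths
  \<open>\<bar>r + (q + k) * n\<bar>\<close>; none is below the smaller of \<open>r\<close> and
  \<open>n - r\<close>, which is attained.\<close>

lemma circle_dist_sq:
  assumes "n > 0" and st: "s - t = 2 * pi * of_int u / real n"
  shows "(circle_dist s t)\<^sup>2 = (2 * pi / real n)\<^sup>2 * of_int (sq_dist_mod n u)"
proof -
  define r q where "r = u mod int n" and "q = u div int n"
  have r: "0 \<le> r" "r < int n" and u: "u = q * int n + r"
    using assms(1) by (simp_all add: r_def q_def)
  have arc: "\<bar>s - t + 2 * pi * of_int k\<bar> = 2 * pi / n * of_int \<bar>r + (q + k) * int n\<bar>" for k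
  proof -
    have "s - t + 2 * pi * of_int k = 2 * pi / n * of_int (r + (q + k) * int n)"
      unfolding st using assms(1) by (simp add: u field_simps)
    then show ?thesis
      by (simp add: abs_mult)
  qed
  \<comment> \<open>The winding number of a shortest arc: \<open>- q\<close> leaves
    \<open>r\<close>, and \<open>- q - 1\<close> leaves \<open>r - n\<close>.\<close>
  define k0 where "k0 = (if r \<le> int n - r then - q else - q - 1)"
  have least: "min r (int n - r) \<le> \<bar>r + (q + k) * int n\<bar>" for k
  proof (cases "q + k \<ge> 0")
    case True
    then have "r \<le> r + (q + k) * int n" by simp
    then show ?thesis using r by linarith
  next
    case False
    then have "(q + k) * int n \<le> (-1) * int n"
      by (intro mult_right_mono) auto
    then show ?thesis using r by linarith
  qed
  have "circle_dist s t = 2 * pi / n * of_int (min r (int n - r))"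
    unfolding circle_dist_def arc
  proof (rule cInf_eq_minimum)
    show "2 * pi / n * of_int (min r (int n - r))
        \<in> range (\<lambda>k. 2 * pi / n * of_int \<bar>r + (q + k) * int n\<bar>)"
      by (rule range_eqI[of _ _ k0]) (use r in \<open>auto simp: k0_def min_def\<close>)
  next
    fix x assume "x \<in> range (\<lambda>k. 2 * pi / n * of_int \<bar>r + (q + k) * int n\<bar>)"
    then obtain k where "x = 2 * pi / n * of_int \<bar>r + (q + k) * int n\<bar>" by blast
    then show "2 * pi / n * of_int (min r (int n - r)) \<le> x"
      using least[of k] by (simp only:, intro mult_left_mono) (simp_all only: of_int_le_iff, simp)
  qed
  then show ?thesis
    by (simp add: power_mult_distrib power_divide sq_dist_mod_def r_def)
qed

text \<open>Any representative of \<open>u\<close> within half a turn of 0 can replace the residue,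
  so the function is a parabola on each such window; at an antipode both parabolas apply.\<close>

lemma sq_dist_mod_eq:
  assumes "n > 0" "2 * \<bar>u - k * int n\<bar> \<le> int n"
  shows "sq_dist_mod n u = (u - k * int n)\<^sup>2"
proof -
  define v where "v = u - k * int n"
  have u: "u mod int n = v mod int n"
    by (simp add: v_def mod_diff_eq[symmetric])
  have v: "2 * \<bar>v\<bar> \<le> int n" using assms(2) v_def by simp
  show ?thesis
  proof (cases "v \<ge> 0")
    case True
    then have "v mod int n = v" using v assms(1) by (intro mod_pos_pos_trivial) auto
    then show ?thesis using v True unfolding sq_dist_mod_def u v_def[symmetric] by (simp add: min_def)
  next
    case False
    have "v mod int n = (v + int n) mod int n" by simp
    also have "\<dots> = v + int n" using v assms(1) False by (intro mod_pos_pos_trivial) auto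
    finally have "min (v mod int n) (int n - v mod int n) = - v"
      using v False by linarith
    then show ?thesis unfolding sq_dist_mod_def u v_def[symmetric] by simp
  qed
qed

text \<open>The squared distance is quadratic except for a kink at the antipode, so its second
  difference is constant up to a point mass there; the discrete Fourier transform of the latter
  is elementary.\<close>

lemma sq_dist_mod_second_difference:
  assumes n: "n \<ge> 2" and s: "s < n"
  shows "sq_dist_mod n (int s + 1) + sq_dist_mod n (int s - 1) - 2 * sq_dist_mod n (int s) =
    2 - int n * (of_bool (s = n div 2) + of_bool (s = n - n div 2))"
proof -
  note near0 = sq_dist_mod_eq[of n _ 0, simplified] and near1 = sq_dist_mod_eq[of n _ 1, simplified]
  \<comment> \<open>The first two cases stay on one parabola. The others straddle the antipode: for
    even \<open>n\<close> it is a point, counted twice; for odd \<open>n\<close> it lies midway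
    between two points, counted once each.\<close>
  consider "2 * s + 2 \<le> n" | "2 * s \<ge> n + 2" | "n = 2 * s" | "n = 2 * s + 1" | "s > 0" "n = 2 * s - 1"
    by linarith
  then show ?thesis
  proof cases
    case 1
    then have "s \<noteq> n div 2" "s \<noteq> n - n div 2" using n by linarith+
    moreover have "sq_dist_mod n (int s + 1) = (int s + 1)\<^sup>2"
      by (rule near0) (use 1 n s in arith)+
    moreover have "sq_dist_mod n (int s - 1) = (int s - 1)\<^sup>2"
      by (rule near0) (use 1 n s in arith)+
    moreover have "sq_dist_mod n (int s) = (int s)\<^sup>2"
      by (rule near0) (use 1 n s in arith)+
    ultimately show ?thesis by (simp add: power2_eq_square algebra_simps)
  next
    case 2
    then have "s \<noteq> n div 2" "s \<noteq> n - n div 2" by linarith+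
    moreover have "sq_dist_mod n (int s + 1) = (int s + 1 - int n)\<^sup>2"
      by (rule near1) (use 2 n s in arith)+
    moreover have "sq_dist_mod n (int s - 1) = (int s - 1 - int n)\<^sup>2"
      by (rule near1) (use 2 n s in arith)+
    moreover have "sq_dist_mod n (int s) = (int s - int n)\<^sup>2"
      by (rule near1) (use 2 n s in arith)+
    ultimately show ?thesis by (simp add: power2_eq_square algebra_simps)
  next
    case 3
    have "sq_dist_mod n (int s + 1) = (int s + 1 - int n)\<^sup>2"
      by (rule near1) (use 3 n s in arith)+
    moreover have "sq_dist_mod n (int s - 1) = (int s - 1)\<^sup>2"
      by (rule near0) (use 3 n s in arith)+
    moreover have "sq_dist_mod n (int s) = (int s)\<^sup>2"
      by (rule near0) (use 3 n s in arith)+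
    ultimately show ?thesis using 3 by (auto simp: power2_eq_square algebra_simps)
  next
    case 4
    have "sq_dist_mod n (int s + 1) = (int s + 1 - int n)\<^sup>2"
      by (rule near1) (use 4 n s in arith)+
    moreover have "sq_dist_mod n (int s - 1) = (int s - 1)\<^sup>2"
      by (rule near0) (use 4 n s in arith)+
    moreover have "sq_dist_mod n (int s) = (int s)\<^sup>2"
      by (rule near0) (use 4 n s in arith)+
    ultimately show ?thesis using 4 by (auto simp: power2_eq_square algebra_simps)
  next
    case 5
    have "sq_dist_mod n (int s + 1) = (int s + 1 - int n)\<^sup>2"
      by (rule near1) (use 5 n s in arith)+
    moreover have "sq_dist_mod n (int s - 1) = (int s - 1)\<^sup>2"
      by (rule near0) (use 5 n s in arith)+
    moreover have "sq_dist_mod n (int s) = (int s - int n)\<^sup>2"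
      by (rule near1) (use 5 n s in arith)+
    moreover have "s \<noteq> n div 2" "s = n - n div 2" using 5 n by linarith+
    ultimately show ?thesis using 5(1)
      unfolding 5(2) by (auto simp: power2_eq_square algebra_simps of_nat_diff)
  qed
qed

lemma sum_periodic_shift:
  fixes G :: "int \<Rightarrow> 'a::ab_group_add"
  assumes per: "\<And>u. G (u + int n) = G u"
  shows "(\<Sum>s<n. G (int s - int k)) = (\<Sum>s<n. G (int s))"
proof (induction k)
  case (Suc k)
  show ?case
  proof (cases n)
    case (Suc N)
    have "(\<Sum>s<n. G (int s - int (Suc k))) = G (- int (Suc k)) + (\<Sum>s<N. G (int s - int k))"
      unfolding Suc sum.lessThan_Suc_shift by (simp add: algebra_simps)
    also have "G (- int (Suc k)) = G (int N - int k)"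
      using per[of "- int (Suc k)"] by (simp add: Suc algebra_simps)
    also have "G (int N - int k) + (\<Sum>s<N. G (int s - int k)) = (\<Sum>s<n. G (int s - int k))"
      by (simp add: Suc add.commute)
    finally show ?thesis using Suc.IH by simp
  qed simp
qed simp

lemma cis_add_2pi_int: "cis (x + 2 * pi * of_int k) = cis x"
  by (simp add: cis_mult[symmetric])

lemma sum_roots_of_unity:
  assumes n: "n > 0" and u: "\<not> int n dvd u"
  shows "(\<Sum>s<n. cis (2 * pi * of_int u * real s / real n)) = 0"
proof -
  define z where "z = cis (2 * pi * of_int u / n)"
  have "z \<noteq> 1"
  proof
    assume "z = 1"
    then have "cos (2 * pi * of_int u / n) = 1"
      by (simp add: z_def complex_eq_iff)
    then obtain k :: int where "2 * pi * of_int u / n = of_int k * 2 * pi"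
      by (auto simp: cos_one_2pi_int)
    then have "real_of_int u = of_int (k * int n)" using n by (simp add: field_simps)
    then show False using u by (metis dvd_triv_right of_int_eq_iff)
  qed
  moreover have "z ^ n = 1" using n by (simp add: z_def DeMoivre)
  ultimately have "(\<Sum>s<n. z ^ s) = 0" by (simp add: geometric_sum)
  then show ?thesis by (simp add: z_def DeMoivre mult.commute mult.left_commute)
qed

text \<open>Shifting the argument by one multiplies the transform \<open>S\<close> by
  \<open>w 1\<close> or \<open>w (-1)\<close>, so taking second differences multiplies it by
  \<open>w 1 + w (-1) - 2\<close>. On the other side the constant sums to 0 and the point masses
  leave a cosine.\<close>

lemma sum_sq_dist_mod_cis:
  assumes n: "n > 0" and l: "0 < l" "l < n"
  shows "(\<Sum>s<n. of_int (sq_dist_mod n (int s)) * cis (2 * pi * real l * real s / real n)) =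
    of_real (n * cos (2 * pi * real l * real (n div 2) / n) / (2 * (sin (pi * real l / n))\<^sup>2))"
proof -
  define w where "w u = cis (2 * pi * real l * of_int u / real n)" for u :: int
  define x where "x = 2 * pi * real l / n"
  have w_per: "w (u + int n) = w u" for u
    using n cis_add_2pi_int[of "2 * pi * real l * of_int u / real n" "int l"]
    by (simp add: w_def field_simps)
  have w_add: "w (u + v) = w u * w v" for u v
    by (simp add: w_def cis_mult add_divide_distrib ring_distribs)
  define sq where "sq = sq_dist_mod n"
  have sq_per: "sq (u + int n) = sq u" for u
    by (simp add: sq_dist_mod_def sq_def)
  define S where "S = (\<Sum>s<n. of_int (sq (int s)) * w (int s))"
  have down: "(\<Sum>s<n. of_int (sq (int s - 1)) * w (int s)) = S * w 1"
  proof -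
    have "(\<Sum>s<n. of_int (sq (int s - 1)) * w (int s)) =
        (\<Sum>s<n. of_int (sq (int s - 1)) * w (int s - 1)) * w 1"
      by (simp add: sum_distrib_right mult.assoc flip: w_add)
    also have "(\<Sum>s<n. of_int (sq (int s - 1)) * w (int s - 1)) = S"
      unfolding S_def using sum_periodic_shift[of "\<lambda>u. of_int (sq u) * w u" n 1]
      by (simp add: w_per sq_per)
    finally show ?thesis .
  qed
  have up: "(\<Sum>s<n. of_int (sq (int s + 1)) * w (int s)) = S * w (-1)"
  proof -
    have "(\<Sum>s<n. of_int (sq (int s + 1)) * w (int s)) =
        (\<Sum>s<n. of_int (sq (int s + 1)) * w (int s + 1)) * w (-1)"
      by (simp add: sum_distrib_right mult.assoc flip: w_add)
    also have "(\<Sum>s<n. of_int (sq (int s + 1)) * w (int s + 1)) = S"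
      unfolding S_def using sum_periodic_shift[of "\<lambda>u. of_int (sq (u + 1)) * w (u + 1)" n 1]
        w_per[of "_ + 1"] sq_per[of "_ + 1"]
      by (simp add: algebra_simps)
    finally show ?thesis .
  qed
  have point_mass: "(\<Sum>s<n. of_bool (s = h) * w (int s)) = w (int h)" if "h < n" for h
  proof -
    have "(\<Sum>s<n. of_bool (s = h) * w (int s)) = (\<Sum>s<n. if s = h then w (int s) else 0)"
      by (intro sum.cong) auto
    then show ?thesis using that by simp
  qed
  have "S * (w 1 + w (-1) - 2) =
      (\<Sum>s<n. of_int (sq (int s + 1) + sq (int s - 1) - 2 * sq (int s)) * w (int s))"
    using up down
    by (simp add: algebra_simps sum.distrib sum_subtractf S_def sum_distrib_left)
  also have "\<dots> = (\<Sum>s<n. 2 * w (int s) - of_nat n * (of_bool (s = n div 2) * w (int s))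
      - of_nat n * (of_bool (s = n - n div 2) * w (int s)))"
    unfolding sq_def using l
    by (intro sum.cong refl, subst sq_dist_mod_second_difference) (auto simp: algebra_simps)
  also have "\<dots> = 2 * (\<Sum>s<n. w (int s)) - of_nat n * (\<Sum>s<n. of_bool (s = n div 2) * w (int s))
      - of_nat n * (\<Sum>s<n. of_bool (s = n - n div 2) * w (int s))"
    by (simp only: sum_subtractf sum_distrib_left)
  also have "(\<Sum>s<n. w (int s)) = 0"
    using sum_roots_of_unity[OF n, of "int l"] l
    by (simp add: w_def nat_dvd_not_less)
  also have "(\<Sum>s<n. of_bool (s = n div 2) * w (int s)) = w (int (n div 2))"
    by (rule point_mass) (use l in auto)
  also have "(\<Sum>s<n. of_bool (s = n - n div 2) * w (int s)) = w (int (n - n div 2))"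
    by (rule point_mass) (use l in auto)
  \<comment> \<open>The point masses sit at opposite residues modulo \<open>n\<close>, so their
    contributions are conjugate and add up to a real cosine.\<close>
  also have "w (int (n - n div 2)) = w (- int (n div 2))"
    using w_per[of "- int (n div 2)"] by (simp add: of_nat_diff)
  also have "2 * 0 - of_nat n * w (int (n div 2)) - of_nat n * w (- int (n div 2)) =
      of_real (- 2 * n * cos (2 * pi * real l * real (n div 2) / n))"
    by (simp add: w_def complex_eq_iff)
  also have "w 1 + w (-1) - 2 = of_real (2 * cos x - 2)"
    by (simp add: w_def complex_eq_iff x_def)
  also have "2 * cos x - 2 = - 4 * (sin (pi * real l / n))\<^sup>2"
    using cos_double_sin[of "pi * real l / n"] by (simp add: x_def mult.assoc)
  finally have "S * of_real (- 4 * (sin (pi * real l / n))\<^sup>2) =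
     of_real (- 2 * n * cos (2 * pi * real l * real (n div 2) / n))" .
  moreover have "sin (pi * real l / n) > 0"
    using l by (intro sin_gt_zero) (auto simp: field_simps)
  ultimately have "S = of_real (- 2 * n * cos (2 * pi * real l * real (n div 2) / n)) /
      of_real (- 4 * (sin (pi * real l / n))\<^sup>2)"
    by (simp add: eq_divide_eq ac_simps)
  then show ?thesis
    by (simp add: S_def sq_def w_def)
qed

section \<open>The spectrum in closed form\<close>

text \<open>The second difference yields this formula only for \<open>0 < l\<close>. At \<open>l = 0\<close> the division by zero
  gives 0, which is the eigenvalue of the constant vector.\<close>

definition mds_eigval :: "nat \<Rightarrow> nat \<Rightarrow> real" where
  "mds_eigval n l =
     - (pi\<^sup>2 / real n) * (cos (2 * pi * real l * real (n div 2) / n) / (sin (pi * real l / n))\<^sup>2)"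

lemma mds_eigval_0 [simp]: "mds_eigval n 0 = 0"
  by (simp add: mds_eigval_def)

section \<open>Symmetry, sign and monotonicity of the eigenvalues\<close>

lemma mds_eigval_mirror:
  assumes "n > 0" "l \<le> n"
  shows "mds_eigval n (n - l) = mds_eigval n l"
proof -
  have "2 * pi * real (n - l) * real (n div 2) / n =
      2 * pi * of_int (int (n div 2)) - 2 * pi * real l * real (n div 2) / n"
    using assms by (simp add: of_nat_diff field_simps)
  then have "cos (2 * pi * real (n - l) * real (n div 2) / n) = cos (2 * pi * real l * real (n div 2) / n)"
    using cos_int_2pin[of "int (n div 2)"] sin_int_2pin[of "int (n div 2)"] by (simp add: cos_diff)
  moreover have "pi * real (n - l) / n = pi - pi * real l / n"
    using assms by (simp add: of_nat_diff field_simps)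
  ultimately show ?thesis by (simp add: mds_eigval_def)
qed

text \<open>Evaluating \<open>n div 2\<close> by parity turns the angle of the cosine into
  \<open>pi * l\<close> or \<open>pi * l - pi * l / n\<close>. For \<open>l\<close> up to
  \<open>n / 2\<close> the sign then sits in \<open>(-1) ^ (l + 1)\<close> alone.\<close>

lemma mds_eigval_eq:
  assumes "n > 0"
  shows "mds_eigval n l = (-1) ^ (l + 1) * (pi\<^sup>2 / real n) *
    ((if even n then 1 else cos (pi * real l / n)) / (sin (pi * real l / n))\<^sup>2)"
proof -
  have "cos (2 * pi * real l * real (n div 2) / n) = (-1) ^ l * (if even n then 1 else cos (pi * real l / n))"
  proof (cases "even n")
    case True
    then have "2 * pi * real l * real (n div 2) / n = pi * real l"
      using assms by (auto elim!: evenE)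
    then show ?thesis using True by simp
  next
    case False
    then have half: "real (n div 2) = (real n - 1) / 2"
      by (auto elim!: oddE)
    have "2 * pi * real l * real (n div 2) / n = pi * real l - pi * real l / n"
      unfolding half using assms by (simp add: field_simps)
    then show ?thesis using False by (simp add: cos_diff)
  qed
  then show ?thesis by (simp add: mds_eigval_def)
qed

lemma mds_eigval_pos:
  assumes "odd l" "2 * l \<le> n"
  shows "mds_eigval n l > 0"
proof -
  have l: "l > 0" using assms by (auto elim: oddE)
  with assms have "n > 0" by simp
  have "sin (pi * real l / n) > 0"
    using l assms by (intro sin_gt_zero) (auto simp: field_simps)
  \<comment> \<open>In this range the cosine vanishes only at \<open>2 * l = n\<close>, which an odd
    \<open>n\<close> rules out.\<close>
  moreover have "cos (pi * real l / n) > 0" if "odd n"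
  proof -
    have "2 * l \<noteq> n" using that by auto
    then have "2 * l < n" using assms by simp
    then have "2 * real l < real n" by linarith
    then show ?thesis using l by (intro cos_gt_zero) (auto simp: field_simps)
  qed
  ultimately show ?thesis
    using assms \<open>n > 0\<close> by (auto simp: mds_eigval_eq)
qed

lemma mds_eigval_nonpos:
  assumes "even l" "2 * l \<le> n"
  shows "mds_eigval n l \<le> 0"
proof (cases "n > 0")
  case True
  have "2 * real l \<le> real n" using assms by linarith
  then have "cos (pi * real l / n) \<ge> 0"
    using True by (intro cos_ge_zero) (auto simp: field_simps intro: order_trans[of _ 0])
  then show ?thesis
    using assms True by (auto simp: mds_eigval_eq intro!: divide_nonneg_nonneg)
qed (simp add: mds_eigval_def)

text \<open>As the angle grows within the first quarter turn, the numerator does not increase and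
  the squared sine strictly increases; the quotients are compared through a mixed one.\<close>

lemma mds_eigval_less:
  assumes kl: "odd k" "odd l" "k < l" "2 * l \<le> n"
  shows "mds_eigval n l < mds_eigval n k"
proof -
  have "k > 0" using kl by (auto elim: oddE)
  have n: "n > 0" using kl by simp
  have l2: "2 * real l \<le> real n" using kl by linarith
  define x y where "x = pi * real k / n" and "y = pi * real l / n"
  have x: "0 < x" "x < y" using \<open>k > 0\<close> n kl by (simp_all add: x_def y_def divide_strict_right_mono)
  have y: "y \<le> pi / 2" using l2 n by (simp add: y_def field_simps)
  have "sin x < sin y" using x y by (intro sin_monotone_2pi) auto
  moreover have "sin x > 0" using x y by (intro sin_gt_zero) auto
  moreover have "cos y \<le> cos x" using x y by (intro cos_monotone_0_pi_le) auto
  moreover have "cos y \<ge> 0" using x y by (intro cos_ge_zero) auto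
  moreover have "cos x > 0" using x y by (intro cos_gt_zero) auto
  ultimately have "(if even n then 1 else cos y) / (sin y)\<^sup>2 \<le> (if even n then 1 else cos x) / (sin y)\<^sup>2"
    "(if even n then 1 else cos x) / (sin y)\<^sup>2 < (if even n then 1 else cos x) / (sin x)\<^sup>2"
    by (auto intro!: divide_right_mono divide_strict_left_mono power_strict_mono mult_pos_pos)
  then have "(if even n then 1 else cos y) / (sin y)\<^sup>2 < (if even n then 1 else cos x) / (sin x)\<^sup>2"
    by (rule order.strict_trans1)
  then have "pi\<^sup>2 / n * ((if even n then 1 else cos y) / (sin y)\<^sup>2) <
      pi\<^sup>2 / n * ((if even n then 1 else cos x) / (sin x)\<^sup>2)"
    using n by (intro mult_strict_left_mono) simp_all
  moreover have "mds_eigval n j = pi\<^sup>2 / n *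
      ((if even n then 1 else cos (pi * real j / n)) / (sin (pi * real j / n))\<^sup>2)" if "odd j" for j
    using mds_eigval_eq[OF n, of j] that by simp
  ultimately show ?thesis
    using kl unfolding x_def y_def by simp
qed

lemma mds_eigval_le:
  assumes "odd k" "odd l" "k \<le> l" "2 * l \<le> n"
  shows "mds_eigval n l \<le> mds_eigval n k"
  using mds_eigval_less[of k l n] assms by (cases "k = l") auto

text \<open>Frequencies above \<open>n / 2\<close> are folded back by the mirror symmetry, and an
  even frequency in the lower half gives no positive value. Strictness in the second case keeps
  \<open>n / 2\<close> from falling under both.\<close>

lemma mds_eigval_pos_cases:
  assumes "l < n" "mds_eigval n l > 0"
  obtains "odd l" "2 * l \<le> n" | "odd (n - l)" "2 * (n - l) < n"
proof (cases "2 * l \<le> n")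
  case True
  then show ?thesis using mds_eigval_nonpos[of l n] assms that(1) by force
next
  case False
  then show ?thesis
    using mds_eigval_nonpos[of "n - l" n] mds_eigval_mirror[of n l] assms that(2) by force
qed

text \<open>Strict monotonicity makes the value unique in the lower half, and folding adds only the
  mirror image. So such an eigenspace has dimension two, or one if \<open>2 * k = n\<close>.\<close>

lemma mds_eigval_eq_iff:
  assumes "odd k" "2 * k \<le> n" "l < n"
  shows "mds_eigval n l = mds_eigval n k \<longleftrightarrow> l = k \<or> l = n - k"
proof
  assume eq: "mds_eigval n l = mds_eigval n k"
  have unique: "j = k" if "odd j" "2 * j \<le> n" "mds_eigval n j = mds_eigval n k" for j
    using mds_eigval_less[of j k n] mds_eigval_less[of k j n] that assms by (cases j k rule: linorder_cases) auto
  have "mds_eigval n l > 0" using mds_eigval_pos[of k n] assms eq by simp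
  with \<open>l < n\<close> show "l = k \<or> l = n - k"
  proof (cases rule: mds_eigval_pos_cases)
    case 1
    then show ?thesis using unique[of l] eq by simp
  next
    case 2
    then have "n - l = k" using unique[of "n - l"] eq mds_eigval_mirror[of n l] assms by simp
    then show ?thesis using assms by linarith
  qed
next
  assume "l = k \<or> l = n - k"
  then show "mds_eigval n l = mds_eigval n k"
    using mds_eigval_mirror[of n k] assms by auto
qed

section \<open>The order of the positive eigenvalues\<close>

lemma nth_rev_sorted_list_of_multiset_image:
  fixes \<mu> :: "'a \<Rightarrow> 'b::linorder"
  assumes fin: "finite A" and inj: "inj_on t {..<m}" and sub: "t ` {..<m} \<subseteq> A"
    and anti: "\<And>i j. i \<le> j \<Longrightarrow> j < m \<Longrightarrow> \<mu> (t j) \<le> \<mu> (t i)"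
    and rest: "\<And>l i. l \<in> A - t ` {..<m} \<Longrightarrow> i < m \<Longrightarrow> \<mu> l \<le> \<mu> (t i)"
    and i: "i < m"
  shows "rev (sorted_list_of_multiset (image_mset \<mu> (mset_set A))) ! i = \<mu> (t i)"
proof -
  define R where "R = sorted_list_of_multiset (image_mset \<mu> (mset_set (A - t ` {..<m})))"
  \<comment> \<open>The other values in ascending order, then the chosen ones from last to first: a
    sorted list with the right multiset, hence the sorted list.\<close>
  define xs where "xs = R @ rev (map (\<mu> \<circ> t) [0..<m])"
  have "mset_set A = mset_set (A - t ` {..<m}) + mset_set (t ` {..<m})"
    using fin sub by (subst mset_set_Union[symmetric]) (auto simp: Un_absorb2)
  also have "mset_set (t ` {..<m}) = image_mset t (mset [0..<m])"
    using inj by (simp add: image_mset_mset_set[symmetric] atLeast0LessThan)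
  finally have "mset xs = image_mset \<mu> (mset_set A)"
    by (simp add: xs_def R_def multiset.map_comp)
  moreover have "sorted xs"
    unfolding xs_def
    using fin anti rest
    by (auto simp: sorted_append R_def sorted_rev_iff_nth_mono)
  ultimately have "sorted_list_of_multiset (image_mset \<mu> (mset_set A)) = xs"
    by (metis sorted_list_of_multiset_mset sorted_sort_id)
  then show ?thesis using i by (simp add: xs_def nth_append)
qed

text \<open>The sequence 1, 1, 3, 3, 5, 5, ...: the frequency in coordinate \<open>i\<close> of
  \<open>gamma_curve\<close>.\<close>

definition coord_freq :: "nat \<Rightarrow> nat" where
  "coord_freq i = (if even i then i + 1 else i)"

text \<open>The Fourier mode that is counted as the \<open>i\<close>-th eigenvalue in descending order: the modes with
  frequencies \<open>k\<close> and \<open>n - k\<close> span the same plane as the cosine and sine of frequency \<open>k\<close>.\<close>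

definition spectrum_index :: "nat \<Rightarrow> nat \<Rightarrow> nat" where
  "spectrum_index n i = (if even i then i + 1 else n - i)"

lemma odd_coord_freq [simp]: "odd (coord_freq i)"
  by (simp add: coord_freq_def)

lemma coord_freq_mono: "i \<le> j \<Longrightarrow> coord_freq i \<le> coord_freq j"
  by (cases "i = j") (auto simp: coord_freq_def)

text \<open>Every positive eigenvalue takes an index from the initial segment \<open>I\<close>, so
  \<open>I\<close> contains all indices below \<open>m\<close>. Equality
  \<open>2 * coord_freq i = n\<close> remains possible only for an unpaired last cosine.\<close>

lemma coord_freq_bounds:
  assumes m: "m \<le> card {l. l < n \<and> mds_eigval n l > 0}" and i: "i < m"
  shows "2 * coord_freq i \<le> n" and "odd i \<or> i + 1 < m \<Longrightarrow> 2 * coord_freq i < n"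
proof -
  \<comment> \<open>There is just one mode of frequency \<open>n / 2\<close>, so the odd index of
    that pair is left out.\<close>
  define I where "I = {i. 2 * coord_freq i \<le> n \<and> (odd i \<longrightarrow> 2 * i < n)}"
  have "I \<subseteq> {..n}" by (auto simp: I_def coord_freq_def split: if_splits)
  then have fin: "finite I" by (rule finite_subset) simp
  have "{l. l < n \<and> mds_eigval n l > 0} \<subseteq> spectrum_index n ` I"
  proof safe
    fix l assume "l < n" "mds_eigval n l > 0"
    then show "l \<in> spectrum_index n ` I"
    proof (cases rule: mds_eigval_pos_cases)
      case 1
      then have "l > 0" by (auto elim: oddE)
      then show ?thesis using 1
        by (intro image_eqI[of _ _ "l - 1"]) (auto simp: spectrum_index_def I_def coord_freq_def)
    next
      case 2
      then show ?thesis using \<open>l < n\<close>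
        by (intro image_eqI[of _ _ "n - l"]) (auto simp: spectrum_index_def I_def coord_freq_def)
    qed
  qed
  then have "m \<le> card I"
    using m surj_card_le[OF fin] by (meson le_trans)
  have down: "i' \<in> I" if "i \<in> I" "i' \<le> i" for i i'
    using that coord_freq_mono[of i' i]
    by (cases "i' = i") (auto simp: I_def coord_freq_def split: if_splits)
  have in_I: "j \<in> I" if "j < m" for j
  proof (rule ccontr)
    assume "j \<notin> I"
    then have "I \<subseteq> {..<j}" using down by (meson lessThan_iff linorder_not_less subsetI)
    then have "card I \<le> j" using card_mono[of "{..<j}" I] by simp
    then show False using that \<open>m \<le> card I\<close> by simp
  qed
  show "2 * coord_freq i \<le> n" using in_I[OF i] by (simp add: I_def)
  show "2 * coord_freq i < n" if "odd i \<or> i + 1 < m"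
    using that in_I[OF i] in_I[of "i + 1"] by (cases "even i") (auto simp: I_def coord_freq_def)
qed

lemma nth_sorted_mds_eigval:
  assumes m: "m \<le> card {l. l < n \<and> mds_eigval n l > 0}" and i: "i < m"
  shows "rev (sorted_list_of_multiset (image_mset (mds_eigval n) (mset_set {..<n}))) ! i =
    mds_eigval n (coord_freq i)"
proof -
  note bounds = coord_freq_bounds[OF m]
  have t: "mds_eigval n (spectrum_index n i) = mds_eigval n (coord_freq i)" if "i < m" for i
    using bounds[OF that] mds_eigval_mirror[of n i]
    by (auto simp: spectrum_index_def coord_freq_def)
  have "rev (sorted_list_of_multiset (image_mset (mds_eigval n) (mset_set {..<n}))) ! i =
      mds_eigval n (spectrum_index n i)"
  proof (rule nth_rev_sorted_list_of_multiset_image[where m = m])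
    show "inj_on (spectrum_index n) {..<m}"
    proof (rule inj_onI)
      \<comment> \<open>Even indices give modes up to \<open>n / 2\<close>, odd ones modes above it
        by the strict bound, so the two kinds do not collide.\<close>
      fix i j assume ij: "i \<in> {..<m}" "j \<in> {..<m}" "spectrum_index n i = spectrum_index n j"
      then show "i = j"
        using bounds[of i] bounds[of j]
        by (auto simp: spectrum_index_def coord_freq_def split: if_splits)
    qed
    show "spectrum_index n ` {..<m} \<subseteq> {..<n}"
    proof safe
      fix i assume "i < m"
      then show "spectrum_index n i < n"
        using bounds[of i] by (auto simp: spectrum_index_def coord_freq_def split: if_splits elim: oddE)
    qed
    show "mds_eigval n (spectrum_index n j) \<le> mds_eigval n (spectrum_index n i)"
      if "i \<le> j" "j < m" for i j
      using that bounds(1)[of j] by (simp add: t mds_eigval_le coord_freq_mono)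
    show "mds_eigval n l \<le> mds_eigval n (spectrum_index n i)"
      if l: "l \<in> {..<n} - spectrum_index n ` {..<m}" and i: "i < m" for l i
    \<comment> \<open>A mode with a value above the \<open>i\<close>-th has a folded frequency below
      \<open>coord_freq i\<close>; its index is then below \<open>m\<close>, so it was already
      listed.\<close>
    proof (rule ccontr)
      assume "\<not> ?thesis"
      then have less: "mds_eigval n (coord_freq i) < mds_eigval n l" using t[OF i] by simp
      then have "mds_eigval n l > 0"
        using mds_eigval_pos[of "coord_freq i" n] bounds(1)[OF i] by simp
      moreover have "l < n" using l by simp
      ultimately consider (low) "odd l" "2 * l \<le> n" | (high) "odd (n - l)" "2 * (n - l) < n"
        using mds_eigval_pos_cases by blast
      then show False
      proof cases
        case low
        have "l < coord_freq i"
          using mds_eigval_le[of "coord_freq i" l n] low less by force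
        moreover have "l > 0" using low by (auto elim: oddE)
        ultimately have "l - 1 < m" "even (l - 1)" "l = l - 1 + 1"
          using i low by (auto simp: coord_freq_def split: if_splits)
        then have "l = spectrum_index n (l - 1)" "l - 1 < m" by (simp_all add: spectrum_index_def)
        then show False using l by blast
      next
        case high
        have "mds_eigval n (n - l) = mds_eigval n l"
          using mds_eigval_mirror[of n l] \<open>l < n\<close> by simp
        then have "n - l < coord_freq i"
          using mds_eigval_le[of "coord_freq i" "n - l" n] high less by force
        then have "n - l < m"
          using i high by (cases "n - l = i") (auto simp: coord_freq_def split: if_splits)
        moreover have "l = spectrum_index n (n - l)"
          using high \<open>l < n\<close> by (simp add: spectrum_index_def)
        ultimately show False using l by blast
      qed
    qed
  qed (use i in auto)
  then show ?thesis using t[OF i] by simp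
qed

text \<open>For \<open>2 * k = n\<close> the eigenspace is a line: with the phase chosen so that one point
  is a maximum, the cosine is \<open>1\<close> or \<open>-1\<close> at every point, and its mean square is 1 instead of \<open>1 / 2\<close>.\<close>

definition eigvec_scale :: "nat \<Rightarrow> nat \<Rightarrow> real" where
  "eigvec_scale n k = (if 2 * k = n then sqrt (1 / n) else sqrt (2 / n))"

text \<open>Once \<open>n > 2 * j\<close>, the squared radius is \<open>g n * c n\<close>. The limit
  of \<open>g\<close> comes from the sine at small angles; \<open>c\<close>, which depends on the
  parity of \<open>n\<close>, is squeezed between a cosine and 1.\<close>

lemma mds_radius_tendsto:
  assumes j: "odd j"
  shows "(\<lambda>n. eigvec_scale n j * sqrt (mds_eigval n j)) \<longlonglongrightarrow> sqrt 2 / real j"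
proof -
  have j0: "real j > 0" using j by (auto elim: oddE)
  define c where "c n = (if even n then 1 else cos (pi * real j / n))" for n :: nat
  define g where "g n = 2 * pi\<^sup>2 / (real n)\<^sup>2 / (sin (pi * real j / n))\<^sup>2" for n :: nat
  have "(\<lambda>n::nat. cos (pi * real j / n)) \<longlonglongrightarrow> 1"
    using j0 by real_asymp
  then have "c \<longlonglongrightarrow> 1"
    by (rule tendsto_sandwich[OF _ _ _ tendsto_const, rotated 2]) (auto simp: c_def)
  moreover have "g \<longlonglongrightarrow> 2 / (real j)\<^sup>2"
  proof -
    have "2 / (real j)\<^sup>2 = 2 * pi\<^sup>2 * inverse ((pi * real j)\<^sup>2)"
      using j0 by (simp add: field_simps)
    then show ?thesis unfolding g_def using j0 by real_asymp
  qed
  ultimately have "(\<lambda>n. sqrt (g n * c n)) \<longlonglongrightarrow> sqrt (2 / (real j)\<^sup>2 * 1)"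
    by (intro tendsto_intros)
  also have "sqrt (2 / (real j)\<^sup>2 * 1) = sqrt 2 / real j"
    using j0 by (simp add: real_sqrt_divide)
  finally show ?thesis
  proof (rule Lim_transform_eventually)
    show "\<forall>\<^sub>F n in sequentially. sqrt (g n * c n) = eigvec_scale n j * sqrt (mds_eigval n j)"
      using eventually_gt_at_top[of "2 * j"]
    proof eventually_elim
      case (elim n)
      then show ?case using j
        by (simp add: eigvec_scale_def mds_eigval_eq c_def g_def power2_eq_square flip: real_sqrt_mult)
    qed
  qed
qed

section \<open>Diagonalisation of the Gram matrix\<close>

lemma sq_dist_mod_minus: "n > 0 \<Longrightarrow> sq_dist_mod n (- u) = sq_dist_mod n u"
  by (auto simp: sq_dist_mod_def zmod_zminus1_eq_if min_def)

text \<open>\<open>\<sigma> i\<close> is the position, counted from \<open>c\<close>, of the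
  \<open>i\<close>-th listed point. As a permutation it turns sums over points into sums over
  positions.\<close>

locale evenly_spaced_points =
  fixes n :: nat and p :: "nat \<Rightarrow> real" and c :: real and \<sigma> :: "nat \<Rightarrow> nat"
  assumes n_pos: "n > 0"
    and perm: "bij_betw \<sigma> {..<n} {..<n}"
    and p_eq: "i < n \<Longrightarrow> p i = c + 2 * pi * real (\<sigma> i) / real n"

lemma evenly_spaced_imp_points:
  assumes n: "n > 0" and "evenly_spaced n p"
  shows "\<exists>c \<sigma>. evenly_spaced_points n p c \<sigma>"
proof -
  obtain c where p: "bij_betw p {..<n} ((\<lambda>i. c + 2 * pi * real i / real n) ` {..<n})"
    using assms(2) by (auto simp: evenly_spaced_def)
  define g where "g i = c + 2 * pi * real i / real n" for i
  define \<sigma> where "\<sigma> = inv_into {..<n} g \<circ> p"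
  have "inj_on g {..<n}"
    using n by (auto simp: inj_on_def g_def)
  then have "bij_betw g {..<n} (g ` {..<n})"
    by (simp add: bij_betw_def)
  then have "bij_betw \<sigma> {..<n} {..<n}"
    unfolding \<sigma>_def using p unfolding g_def[symmetric] by (auto intro: bij_betw_trans bij_betw_inv_into)
  moreover have "p i = g (\<sigma> i)" if "i < n" for i
  proof -
    have "p i \<in> g ` {..<n}"
      using bij_betwE[OF p] that unfolding g_def[symmetric] by simp
    then show ?thesis by (simp add: \<sigma>_def f_inv_into_f)
  qed
  ultimately have "evenly_spaced_points n p c \<sigma>"
    using n by unfold_locales (auto simp: g_def)
  then show ?thesis by blast
qed

context evenly_spaced_points
begin

lemma sum_over_points: "(\<Sum>j<n. F (\<sigma> j)) = (\<Sum>s<n. F s)"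
  by (rule sum.reindex_bij_betw[OF perm])

lemma sum_cis_points:
  assumes "\<not> int n dvd u"
  shows "(\<Sum>j<n. cis (of_int u * (p j - \<phi>))) = 0"
proof -
  have "(\<Sum>j<n. cis (of_int u * (p j - \<phi>))) =
      (\<Sum>j<n. cis (of_int u * (c - \<phi>)) * cis (2 * pi * of_int u * real (\<sigma> j) / n))"
    by (intro sum.cong refl) (simp add: p_eq cis_mult algebra_simps)
  also have "\<dots> = (\<Sum>s<n. cis (of_int u * (c - \<phi>)) * cis (2 * pi * of_int u * real s / n))"
    by (rule sum_over_points)
  also have "\<dots> = 0"
    by (simp add: sum_roots_of_unity[OF n_pos assms] flip: sum_distrib_left)
  finally show ?thesis .
qed

lemma sum_cos_points: "\<not> int n dvd u \<Longrightarrow> (\<Sum>j<n. cos (of_int u * (p j - \<phi>))) = 0"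
  using arg_cong[OF sum_cis_points, of u Re] by simp

lemma sum_sin_points: "\<not> int n dvd u \<Longrightarrow> (\<Sum>j<n. sin (of_int u * (p j - \<phi>))) = 0"
  using arg_cong[OF sum_cis_points, of u Im] by simp

section \<open>The discrete Fourier basis on the points\<close>

definition fourier :: "complex mat" where
  "fourier = mat n n (\<lambda>(j, l). cis (real l * p j))"

definition fourier_inv :: "complex mat" where
  "fourier_inv = mat n n (\<lambda>(l, j). cis (- (real l * p j)) / of_nat n)"

lemma fourier_carrier [simp]: "fourier \<in> carrier_mat n n" "fourier_inv \<in> carrier_mat n n"
  by (simp_all add: fourier_def fourier_inv_def)

lemma fourier_inv_left: "fourier_inv * fourier = 1\<^sub>m n"
proof (rule eq_matI)
  fix l k assume "l < dim_row (1\<^sub>m n :: complex mat)" "k < dim_col (1\<^sub>m n :: complex mat)"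
  then have lk: "l < n" "k < n" by simp_all
  have "(fourier_inv * fourier) $$ (l, k) = (\<Sum>j<n. cis (of_int (int k - int l) * (p j - 0))) / of_nat n"
    using lk by (simp add: fourier_def fourier_inv_def scalar_prod_def atLeast0LessThan cis_mult
        algebra_simps sum_divide_distrib)
  also have "\<dots> = (if l = k then 1 else 0)"
  proof (cases "l = k")
    case False
    then have "\<not> int n dvd int k - int l"
      using lk by (metis dvd_imp_mod_0 eq_iff_diff_eq_0 mod_eq_dvd_iff mod_pos_pos_trivial of_nat_0_le_iff of_nat_eq_iff of_nat_less_iff)
    then show ?thesis using False sum_cis_points[of "int k - int l" 0] by simp
  qed (use n_pos in simp)
  finally show "(fourier_inv * fourier) $$ (l, k) = 1\<^sub>m n $$ (l, k)"
    using lk by simp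
qed (simp_all add: fourier_def fourier_inv_def)

lemma fourier_inv_right: "fourier * fourier_inv = 1\<^sub>m n"
  by (rule mat_mult_left_right_inverse[OF _ _ fourier_inv_left]) simp_all

abbreviation "dist_gram \<equiv> map_mat (\<lambda>d. - (1 / 2) * d\<^sup>2) (circle_dist_mat n p)"

text \<open>After reordering by position the matrix is circulant, since its entries depend only on
  the difference of positions. Its eigenvalue at a mode is the transform of these entries.\<close>

lemma dist_gram_fourier:
  defines "\<alpha> \<equiv> \<lambda>l. of_real (- (1 / 2) * (2 * pi / n)\<^sup>2) *
    (\<Sum>s<n. of_int (sq_dist_mod n (int s)) * cis (2 * pi * real l * real s / n))"
  shows "map_mat complex_of_real dist_gram * fourier = fourier * mat_diag n \<alpha>"
proof (rule eq_matI)
  fix i l assume "i < dim_row (fourier * mat_diag n \<alpha>)" "l < dim_col (fourier * mat_diag n \<alpha>)"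
  then have il: "i < n" "l < n" by (simp_all add: fourier_def mat_diag_def)
  define C where "C = - (1 / 2) * (2 * pi / n)\<^sup>2"
  define G where "G u = of_int (sq_dist_mod n u) * cis (2 * pi * real l * of_int u / n)" for u :: int
  have G_per: "G (u + int n) = G u" for u
    using n_pos cis_add_2pi_int[of "2 * pi * real l * of_int u / real n" "int l"]
    by (simp add: G_def sq_dist_mod_def field_simps)
  have entry: "complex_of_real (- (1 / 2) * (circle_dist (p i) (p j))\<^sup>2) * cis (real l * p j) =
      of_real C * cis (real l * p i) * G (int (\<sigma> j) - int (\<sigma> i))" if "j < n" for j
  proof -
    have "(circle_dist (p i) (p j))\<^sup>2 = (2 * pi / n)\<^sup>2 * of_int (sq_dist_mod n (int (\<sigma> i) - int (\<sigma> j)))"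
      using il that n_pos by (intro circle_dist_sq) (simp_all add: p_eq field_simps)
    also have "sq_dist_mod n (int (\<sigma> i) - int (\<sigma> j)) = sq_dist_mod n (int (\<sigma> j) - int (\<sigma> i))"
      using sq_dist_mod_minus[OF n_pos, of "int (\<sigma> i) - int (\<sigma> j)"] by simp
    finally have d: "- (1 / 2) * (circle_dist (p i) (p j))\<^sup>2 =
        C * of_int (sq_dist_mod n (int (\<sigma> j) - int (\<sigma> i)))"
      by (simp add: C_def)
    have "real l * p j = real l * p i + 2 * pi * real l * of_int (int (\<sigma> j) - int (\<sigma> i)) / n"
      using il that n_pos by (simp add: p_eq field_simps)
    then have "cis (real l * p j) =
        cis (real l * p i) * cis (2 * pi * real l * of_int (int (\<sigma> j) - int (\<sigma> i)) / n)"
      by (simp only: cis_mult)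
    then show ?thesis by (simp only: d G_def) simp
  qed
  have "(map_mat complex_of_real dist_gram * fourier) $$ (i, l) =
      (\<Sum>j<n. complex_of_real (- (1 / 2) * (circle_dist (p i) (p j))\<^sup>2) * cis (real l * p j))"
    using il by (simp add: fourier_def circle_dist_mat_def scalar_prod_def atLeast0LessThan)
  also have "\<dots> = (\<Sum>j<n. of_real C * cis (real l * p i) * G (int (\<sigma> j) - int (\<sigma> i)))"
    by (intro sum.cong refl entry) simp
  also have "\<dots> = (\<Sum>s<n. of_real C * cis (real l * p i) * G (int s - int (\<sigma> i)))"
    by (rule sum_over_points)
  also have "\<dots> = of_real C * cis (real l * p i) * (\<Sum>s<n. G (int s))"
    by (simp add: sum_periodic_shift[of G, OF G_per] flip: sum_distrib_left)
  also have "\<dots> = (fourier * mat_diag n \<alpha>) $$ (i, l)"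
    using il by (simp add: mat_diag_mult_right[of _ n] fourier_def \<alpha>_def C_def G_def)
  finally show "(map_mat complex_of_real dist_gram * fourier) $$ (i, l) = (fourier * mat_diag n \<alpha>) $$ (i, l)" .
qed (simp_all add: fourier_def circle_dist_mat_def mat_diag_def)

text \<open>Mode 0 is the constant vector, which centering kills; every other mode sums to zero over
  the points and is left alone.\<close>

lemma centering_fourier:
  "map_mat complex_of_real (centering_mat n) * fourier = fourier * mat_diag n (\<lambda>l. of_bool (l > 0))"
proof (rule eq_matI)
  fix i l assume "i < dim_row (fourier * mat_diag n (\<lambda>l. of_bool (l > 0)))"
    "l < dim_col (fourier * mat_diag n (\<lambda>l. of_bool (l > 0)))"
  then have il: "i < n" "l < n" by (simp_all add: fourier_def mat_diag_def)
  have sum: "(\<Sum>j<n. cis (real l * p j)) = of_nat n * of_bool (l = 0)"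
    using sum_cis_points[of "int l" 0] il by (auto simp: nat_dvd_not_less)
  have "(map_mat complex_of_real (centering_mat n) * fourier) $$ (i, l) =
      (\<Sum>j<n. (if j = i then cis (real l * p i) else 0) - cis (real l * p j) / of_nat n)"
    using il by (auto simp: centering_mat_def fourier_def scalar_prod_def atLeast0LessThan
        left_diff_distrib intro!: sum.cong)
  also have "\<dots> = cis (real l * p i) * of_bool (l > 0)"
    using il n_pos by (simp add: sum_subtractf sum flip: sum_divide_distrib)
  also have "\<dots> = (fourier * mat_diag n (\<lambda>l. of_bool (l > 0))) $$ (i, l)"
    using il by (simp add: mat_diag_mult_right[of _ n] fourier_def)
  finally show "(map_mat complex_of_real (centering_mat n) * fourier) $$ (i, l) =
    (fourier * mat_diag n (\<lambda>l. of_bool (l > 0))) $$ (i, l)" .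
qed (simp_all add: fourier_def centering_mat_def mat_diag_def)

abbreviation "gram \<equiv> mds_gram (circle_dist_mat n p)"

lemma gram_eq: "gram = centering_mat n * dist_gram * centering_mat n"
  by (simp add: mds_gram_def circle_dist_mat_def Let_def)

lemma centering_mat_carrier [simp]: "centering_mat n \<in> carrier_mat n n"
  unfolding centering_mat_def by (intro minus_carrier_mat smult_carrier_mat) simp

lemma circle_dist_mat_carrier [simp]: "circle_dist_mat n p \<in> carrier_mat n n"
  by (simp add: circle_dist_mat_def)

lemma gram_carrier [simp]: "gram \<in> carrier_mat n n"
  unfolding gram_eq by (intro mult_carrier_mat[of _ n n]) simp_all

abbreviation "cgram \<equiv> map_mat complex_of_real gram"

lemma gram_fourier:
  "cgram * fourier = fourier * mat_diag n (\<lambda>l. of_real (mds_eigval n l))"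
proof -
  define H where "H = map_mat complex_of_real (centering_mat n)"
  define A where "A = map_mat complex_of_real dist_gram"
  define \<delta> :: "nat \<Rightarrow> complex" where "\<delta> l = of_bool (l > 0)" for l
  define \<alpha> where "\<alpha> l = of_real (- (1 / 2) * (2 * pi / n)\<^sup>2) *
    (\<Sum>s<n. of_int (sq_dist_mod n (int s)) * cis (2 * pi * real l * real s / n))" for l
  have H: "H * fourier = fourier * mat_diag n \<delta>"
    using centering_fourier by (simp add: H_def \<delta>_def[abs_def])
  have A: "A * fourier = fourier * mat_diag n \<alpha>"
    using dist_gram_fourier by (simp add: A_def \<alpha>_def[abs_def])
  have [simp]: "H \<in> carrier_mat n n" "A \<in> carrier_mat n n" by (simp_all add: H_def A_def)
  have D: "dist_gram \<in> carrier_mat n n" by simp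
  have HA: "centering_mat n * dist_gram \<in> carrier_mat n n"
    by (rule mult_carrier_mat[OF centering_mat_carrier D])
  note assoc = assoc_mult_mat[of _ n n _ n _ n] and [simp] = mult_carrier_mat[of _ n n _ n]
  have "cgram = H * A * H"
    unfolding H_def A_def gram_eq of_real_hom.mat_hom_mult[OF HA centering_mat_carrier]
      of_real_hom.mat_hom_mult[OF centering_mat_carrier D] ..
  then have "cgram * fourier = H * (A * (H * fourier))"
    by (simp add: assoc)
  also have "\<dots> = H * ((A * fourier) * mat_diag n \<delta>)"
    by (simp add: H assoc)
  also have "\<dots> = (H * fourier) * (mat_diag n \<alpha> * mat_diag n \<delta>)"
    by (simp only: A) (simp add: assoc del: mat_diag_diag)
  also have "\<dots> = fourier * mat_diag n (\<lambda>l. \<delta> l * (\<alpha> l * \<delta> l))"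
    by (simp add: H assoc)
  also have "mat_diag n (\<lambda>l. \<delta> l * (\<alpha> l * \<delta> l)) = mat_diag n (\<lambda>l. of_real (mds_eigval n l))"
  proof (rule eq_matI)
    fix i l assume "i < dim_row (mat_diag n (\<lambda>l. complex_of_real (mds_eigval n l)))"
      "l < dim_col (mat_diag n (\<lambda>l. complex_of_real (mds_eigval n l)))"
    then have il: "i < n" "l < n" by (simp_all add: mat_diag_def)
    \<comment> \<open>Only \<open>l > 0\<close> calls for the closed form: at \<open>l = 0\<close>
      the factor \<open>\<delta>\<close> gives 0, the value of
      \<open>mds_eigval n 0\<close>.\<close>
    have "\<alpha> l = of_real (mds_eigval n l)" if "l > 0"
      unfolding \<alpha>_def sum_sq_dist_mod_cis[OF n_pos that il(2)] of_real_mult[symmetric]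
      by (simp add: mds_eigval_def power2_eq_square)
    then show "mat_diag n (\<lambda>l. \<delta> l * (\<alpha> l * \<delta> l)) $$ (i, l) =
        mat_diag n (\<lambda>l. of_real (mds_eigval n l)) $$ (i, l)"
      using il by (simp add: mat_diag_def \<delta>_def)
  qed (simp_all add: mat_diag_def)
  finally show ?thesis .
qed

text \<open>Over the complex numbers the matrix is similar to a diagonal one. Both polynomials have
  real coefficients, so they already agree over the reals.\<close>

lemma char_poly_gram: "char_poly gram = (\<Prod>l<n. [:- mds_eigval n l, 1:])"
proof -
  let ?\<Lambda> = "mat_diag n (\<lambda>l. complex_of_real (mds_eigval n l))"
  have [simp]: "cgram \<in> carrier_mat n n" by simp
  have "cgram = cgram * (fourier * fourier_inv)"
    by (simp only: fourier_inv_right right_mult_one_mat[OF \<open>cgram \<in> carrier_mat n n\<close>])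
  also have "\<dots> = fourier * ?\<Lambda> * fourier_inv"
    by (subst assoc_mult_mat[of _ n n _ n _ n, symmetric]) (simp_all add: gram_fourier)
  finally have eq: "cgram = fourier * ?\<Lambda> * fourier_inv" .
  have "similar_mat_wit cgram ?\<Lambda> fourier fourier_inv"
    by (rule similar_mat_witI[OF fourier_inv_right fourier_inv_left eq]) simp_all
  then have "similar_mat cgram ?\<Lambda>"
    unfolding similar_mat_def by blast
  then have "char_poly cgram = char_poly ?\<Lambda>"
    by (rule char_poly_similar)
  also have "\<dots> = (\<Prod>a\<leftarrow>diag_mat ?\<Lambda>. [:- a, 1:])"
    by (rule char_poly_upper_triangular[of _ n]) (auto simp: upper_triangular_def mat_diag_def)
  also have "diag_mat ?\<Lambda> = map (\<lambda>l. of_real (mds_eigval n l)) [0..<n]"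
    by (auto simp: diag_mat_def mat_diag_def)
  also have "(\<Prod>a\<leftarrow>map (\<lambda>l. complex_of_real (mds_eigval n l)) [0..<n]. [:- a, 1:]) =
      (\<Prod>l<n. [:- complex_of_real (mds_eigval n l), 1:])"
    by (simp add: prod.distinct_set_conv_list[symmetric] atLeast0LessThan o_def)
  also have "\<dots> = map_poly of_real (\<Prod>l<n. [:- mds_eigval n l, 1:])"
  proof -
    interpret map_poly_comm_ring_hom complex_of_real ..
    show ?thesis by (simp add: hom_prod)
  qed
  finally have "map_poly complex_of_real (char_poly gram) = map_poly of_real (\<Prod>l<n. [:- mds_eigval n l, 1:])"
    by (simp add: of_real_hom.char_poly_hom[of _ n])
  then show ?thesis
    by (simp add: poly_eq_iff coeff_map_poly)
qed

lemma proots_char_poly_gram: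
  "proots (char_poly gram) = image_mset (mds_eigval n) (mset_set {..<n})"
  by (simp add: char_poly_gram proots_prod sum_unfold_sum_mset)

lemma num_pos_eigvals_gram: "num_pos_eigvals gram = card {l. l < n \<and> mds_eigval n l > 0}"
  by (simp add: num_pos_eigvals_def proots_char_poly_gram filter_mset_image_mset Collect_conj_eq lessThan_def)

lemma nth_eigvals_desc_gram:
  "m \<le> num_pos_eigvals gram \<Longrightarrow> i < m \<Longrightarrow> eigvals_desc gram ! i = mds_eigval n (coord_freq i)"
  by (simp add: eigvals_desc_def proots_char_poly_gram num_pos_eigvals_gram nth_sorted_mds_eigval)

text \<open>In Fourier coordinates the matrix is diagonal, so the coefficients of \<open>v\<close>
  live on the modes with this eigenvalue, \<open>k\<close> and \<open>n - k\<close>. On the points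
  these are conjugate up to a phase, and real parts leave one cosine and one sine.\<close>

lemma gram_eigenspace:
  assumes v: "eigenvector gram v (mds_eigval n k)" and k: "odd k" "2 * k \<le> n"
  shows "\<exists>\<alpha> \<beta>. \<forall>j<n. v $ j = \<alpha> * cos (real k * p j) + \<beta> * sin (real k * p j)"
proof -
  let ?\<Lambda> = "mat_diag n (\<lambda>l. complex_of_real (mds_eigval n l))"
  define w where "w = map_vec complex_of_real v"
  define g where "g = fourier_inv *\<^sub>v w"
  have vc: "v \<in> carrier_vec n" and "gram *\<^sub>v v = mds_eigval n k \<cdot>\<^sub>v v"
    using v carrier_matD[OF gram_carrier] by (simp_all add: eigenvector_def)
  then have w: "w \<in> carrier_vec n" and eig: "cgram *\<^sub>v w = of_real (mds_eigval n k) \<cdot>\<^sub>v w"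
    using of_real_hom.mult_mat_vec_hom[OF gram_carrier vc, where 'a = complex]
    by (simp_all add: w_def of_real_hom.vec_hom_smult)
  have g: "g \<in> carrier_vec n"
    unfolding g_def by (rule mult_mat_vec_carrier[OF _ w]) simp
  have cgram: "cgram \<in> carrier_mat n n" by simp
  have "fourier_inv * cgram = fourier_inv * (cgram * (fourier * fourier_inv))"
    by (simp only: fourier_inv_right right_mult_one_mat[OF cgram])
  also have "cgram * (fourier * fourier_inv) = fourier * (?\<Lambda> * fourier_inv)"
    using cgram by (simp add: gram_fourier assoc_mult_mat[of _ n n _ n _ n]
        flip: assoc_mult_mat[of cgram n n fourier n fourier_inv n])
  also have "fourier_inv * (fourier * (?\<Lambda> * fourier_inv)) = ?\<Lambda> * fourier_inv"
    by (subst assoc_mult_mat[of _ n n _ n _ n, symmetric])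
      (simp_all add: fourier_inv_left left_mult_one_mat[of _ n n] mult_carrier_mat[of _ n n])
  finally have "?\<Lambda> *\<^sub>v g = fourier_inv *\<^sub>v (cgram *\<^sub>v w)"
    unfolding g_def using cgram w
    by (metis assoc_mult_mat_vec fourier_carrier(2) mat_diag_dim)
  also have "\<dots> = of_real (mds_eigval n k) \<cdot>\<^sub>v g"
    unfolding g_def eig using w by (intro mult_mat_vec[of _ n n]) simp_all
  finally have \<Lambda>g: "?\<Lambda> *\<^sub>v g = of_real (mds_eigval n k) \<cdot>\<^sub>v g" .
  have supp: "g $ l = 0" if l: "l < n" "l \<noteq> k" "l \<noteq> n - k" for l
  proof -
    have "(?\<Lambda> *\<^sub>v g) $ l = of_real (mds_eigval n l) * g $ l"
      using l g by (simp add: mat_diag_def scalar_prod_def if_distrib[of "\<lambda>x. x * _"] cong: if_cong)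
    moreover have "(?\<Lambda> *\<^sub>v g) $ l = of_real (mds_eigval n k) * g $ l"
      unfolding \<Lambda>g using l g by simp
    ultimately have "of_real (mds_eigval n l) * g $ l = of_real (mds_eigval n k) * g $ l"
      by metis
    moreover have "mds_eigval n l \<noteq> mds_eigval n k"
      using mds_eigval_eq_iff[OF k l(1)] l by simp
    ultimately show ?thesis
      by (metis mult_cancel_right of_real_eq_iff)
  qed
  have "w = fourier *\<^sub>v g"
    unfolding g_def using w
    by (subst assoc_mult_mat_vec[of _ n n _ n, symmetric]) (simp_all add: fourier_inv_right)
  have v_eq: "v $ j = (\<Sum>l\<in>{k, n - k}. Re (cis (real l * p j) * g $ l))" if j: "j < n" for j
  proof -
    have "complex_of_real (v $ j) = (fourier *\<^sub>v g) $ j"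
      using j vc by (simp add: w_def flip: \<open>w = fourier *\<^sub>v g\<close>)
    also have "\<dots> = (\<Sum>l<n. cis (real l * p j) * g $ l)"
      using j g by (simp add: fourier_def scalar_prod_def atLeast0LessThan)
    also have "\<dots> = (\<Sum>l\<in>{k, n - k}. cis (real l * p j) * g $ l)"
      using supp k by (intro sum.mono_neutral_right) (auto elim: oddE)
    finally show ?thesis
      by (metis Re_complex_of_real Re_sum)
  qed
  have "\<exists>\<alpha> \<beta>. \<forall>j<n. Re (cis (real l * p j) * z) = \<alpha> * cos (real k * p j) + \<beta> * sin (real k * p j)"
    if l: "l \<in> {k, n - k}" for l z
  proof (cases "l = k")
    case True
    then show ?thesis
      by (intro exI[of _ "Re z"] exI[of _ "- Im z"]) simp
  next
    case False
    \<comment> \<open>\<open>n * p j\<close> is \<open>n * c\<close> plus a multiple of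
      \<open>2 * pi\<close>, so the phase between mode \<open>n - k\<close> and the conjugate of
      mode \<open>k\<close> is the same at all points.\<close>
    have "cis (real l * p j) = cis (real n * c) * cis (- (real k * p j))" if "j < n" for j
    proof -
      have "real l * p j = real n * c + - (real k * p j) + 2 * pi * of_int (int (\<sigma> j))"
        using False l k that n_pos by (simp add: of_nat_diff p_eq field_simps)
      then show ?thesis by (simp only: cis_add_2pi_int cis_mult)
    qed
    then have "Re (cis (real l * p j) * z) =
        Re (cis (real n * c) * z) * cos (real k * p j) + Im (cis (real n * c) * z) * sin (real k * p j)"
      if "j < n" for j
      using that by (simp add: algebra_simps)
    then show ?thesis by blast
  qed
  then have "\<forall>l\<in>{k, n - k}. \<exists>ab. \<forall>j<n.
      Re (cis (real l * p j) * g $ l) = fst ab * cos (real k * p j) + snd ab * sin (real k * p j)"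
    by (metis fst_conv snd_conv)
  from bchoice[OF this] obtain ab where
    ab: "\<And>l j. l \<in> {k, n - k} \<Longrightarrow> j < n \<Longrightarrow>
      Re (cis (real l * p j) * g $ l) = fst (ab l) * cos (real k * p j) + snd (ab l) * sin (real k * p j)"
    by blast
  show ?thesis
  proof (intro exI allI impI)
    fix j assume "j < n"
    then show "v $ j = (\<Sum>l\<in>{k, n - k}. fst (ab l)) * cos (real k * p j) +
        (\<Sum>l\<in>{k, n - k}. snd (ab l)) * sin (real k * p j)"
      unfolding v_eq[OF \<open>j < n\<close>] by (simp only: ab sum_distrib_right sum.distrib cong: sum.cong)
  qed
qed

section \<open>Norms and orthogonality of the sampled cosines and sines\<close>

lemma sum_cos_sq_points:
  assumes "0 < k" "2 * k < n"
  shows "(\<Sum>j<n. (cos (real k * (p j - \<phi>)))\<^sup>2) = n / 2"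
    "(\<Sum>j<n. (sin (real k * (p j - \<phi>)))\<^sup>2) = n / 2"
proof -
  \<comment> \<open>By the double angle formulas the squares have mean \<open>1 / 2\<close> plus a
    cosine term of frequency \<open>2 * k\<close>, which is no multiple of \<open>n\<close> and
    cancels in the sum.\<close>
  have "(cos (real k * x))\<^sup>2 = 1 / 2 + cos (of_int (int (2 * k)) * x) / 2"
    "(sin (real k * x))\<^sup>2 = 1 / 2 - cos (of_int (int (2 * k)) * x) / 2" for x
    using cos_double_cos[of "real k * x"] cos_double_sin[of "real k * x"]
    by (simp_all add: mult.assoc field_simps)
  moreover have "\<not> int n dvd int (2 * k)"
    using assms by (auto simp only: int_dvd_int_iff dest: nat_dvd_not_less[rotated])
  ultimately show "(\<Sum>j<n. (cos (real k * (p j - \<phi>)))\<^sup>2) = n / 2"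
    "(\<Sum>j<n. (sin (real k * (p j - \<phi>)))\<^sup>2) = n / 2"
    using sum_cos_points[of "int (2 * k)" \<phi>]
    by (simp_all only: sum.distrib sum_subtractf flip: sum_divide_distrib) simp_all
qed

text \<open>Polar coordinates turn the combination into a shifted cosine, and the unit norm
  determines its amplitude. If \<open>2 * k = n\<close>, the points see only an alternating sign,
  and the norm is computed from that.\<close>

lemma unit_eigenvector_eq_cos:
  assumes k: "0 < k" "2 * k \<le> n"
    and f: "\<And>j. j < n \<Longrightarrow> f j = \<alpha> * cos (real k * p j) + \<beta> * sin (real k * p j)"
    and unit: "(\<Sum>j<n. (f j)\<^sup>2) = 1"
  shows "\<exists>\<phi>. \<forall>j<n. f j = eigvec_scale n k * cos (real k * (p j - \<phi>))"
proof (cases "2 * k = n")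
  case False
  define r \<psi> where "r = cmod (Complex \<alpha> \<beta>)" and "\<psi> = Arg (Complex \<alpha> \<beta>)"
  have "Complex \<alpha> \<beta> = rcis r \<psi>" by (simp add: r_def \<psi>_def rcis_cmod_Arg)
  then have ab: "\<alpha> = r * cos \<psi>" "\<beta> = r * sin \<psi>" by (simp_all add: complex_eq_iff)
  have f_eq: "f j = r * cos (real k * (p j - \<psi> / k))" if "j < n" for j
    using k that by (simp add: f ab right_diff_distrib cos_diff algebra_simps)
  have "(\<Sum>j<n. (f j)\<^sup>2) = r\<^sup>2 * (\<Sum>j<n. (cos (real k * (p j - \<psi> / k)))\<^sup>2)"
    unfolding sum_distrib_left by (intro sum.cong refl) (simp add: f_eq power_mult_distrib)
  also have "\<dots> = r\<^sup>2 * (n / 2)"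
    using k False by (subst sum_cos_sq_points) simp_all
  finally have "r\<^sup>2 = 2 / n"
    using unit n_pos by (simp add: field_simps)
  then have "r = eigvec_scale n k"
    using False real_sqrt_unique[of r] by (simp add: eigvec_scale_def r_def)
  then show ?thesis using f_eq by blast
next
  case True
  define \<rho> where "\<rho> = \<alpha> * cos (real k * c) + \<beta> * sin (real k * c)"
  have kp: "real k * (p j - c) = pi * real (\<sigma> j)" if "j < n" for j
    using that k by (simp add: p_eq True[symmetric])
  have "real k * p j = real k * c + pi * real (\<sigma> j)" if "j < n" for j
    using kp[OF that] by (simp add: algebra_simps)
  then have f_eq: "f j = \<rho> * (-1) ^ \<sigma> j" if "j < n" for j
    using that by (simp add: f \<rho>_def cos_add sin_add algebra_simps)
  have "(\<Sum>j<n. (f j)\<^sup>2) = n * \<rho>\<^sup>2"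
    by (simp add: f_eq power_mult_distrib flip: power_mult)
  then have "\<rho>\<^sup>2 = 1 / n"
    using unit n_pos by (simp add: field_simps)
  then have \<rho>: "\<bar>\<rho>\<bar> = eigvec_scale n k"
    using True by (metis eigvec_scale_def real_sqrt_abs)
  \<comment> \<open>A negative \<open>\<rho>\<close> is made positive by a shift of half a period,
    \<open>pi / k\<close>.\<close>
  define \<phi> where "\<phi> = (if \<rho> \<ge> 0 then c else c + pi / k)"
  have "f j = eigvec_scale n k * cos (real k * (p j - \<phi>))" if "j < n" for j
  proof (cases "\<rho> \<ge> 0")
    case True
    then show ?thesis using that \<rho> by (simp add: f_eq \<phi>_def kp)
  next
    case False
    have "real k * (p j - \<phi>) = pi * real (\<sigma> j) - pi"
      using False kp[OF that] k by (simp add: \<phi>_def field_simps)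
    moreover have "\<rho> = - eigvec_scale n k" using False \<rho> by simp
    ultimately show ?thesis using that by (simp add: f_eq cos_diff)
  qed
  then show ?thesis by blast
qed

text \<open>Coordinate \<open>i\<close> of the curve without its radius, at the parameter
  \<open>p j - \<phi>\<close>; one phase serves all coordinates.\<close>

definition trig :: "real \<Rightarrow> nat \<Rightarrow> nat \<Rightarrow> real" where
  "trig \<phi> i j = (if even i then cos (real (coord_freq i) * (p j - \<phi>))
                else sin (real (coord_freq i) * (p j - \<phi>)))"

text \<open>Products turn into terms at the sum and the difference of the frequencies, and neither
  is a nonzero multiple of \<open>n\<close>. If the difference is 0, one factor is a cosine and the
  other a sine, so only sines appear.\<close>

lemma sum_trig_orthogonal:
  assumes "i \<noteq> i'" "coord_freq i + coord_freq i' < n"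
  shows "(\<Sum>j<n. trig \<phi> i j * trig \<phi> i' j) = 0"
proof -
  let ?k = "coord_freq i" and ?k' = "coord_freq i'"
  let ?d = "int ?k - int ?k'" and ?s = "int ?k + int ?k'"
  have "\<not> n dvd (?k + ?k')"
    using assms(2) odd_pos[OF odd_coord_freq[of i]] by (intro nat_dvd_not_less) simp_all
  then have s: "\<not> int n dvd ?s"
    by (simp flip: of_nat_add)
  have d: "\<not> int n dvd ?d" if "?k \<noteq> ?k'"
  proof
    assume "int n dvd ?d"
    then have "\<bar>int n\<bar> \<le> \<bar>?d\<bar>" using that by (intro dvd_imp_le_int) simp_all
    then show False using assms(2) by linarith
  qed
  have par: "even i \<noteq> even i'" if "?k = ?k'"
    using that assms(1) by (auto simp: coord_freq_def split: if_splits)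
  have cc: "cos (real ?k * x) * cos (real ?k' * x) = (cos (of_int ?d * x) + cos (of_int ?s * x)) / 2" for x
    by (simp add: cos_times_cos ring_distribs)
  have ss: "sin (real ?k * x) * sin (real ?k' * x) = (cos (of_int ?d * x) - cos (of_int ?s * x)) / 2" for x
    by (simp add: sin_times_sin ring_distribs)
  have sc: "sin (real ?k * x) * cos (real ?k' * x) = (sin (of_int ?s * x) + sin (of_int ?d * x)) / 2" for x
    by (simp add: sin_times_cos ring_distribs)
  have cs: "cos (real ?k * x) * sin (real ?k' * x) = (sin (of_int ?s * x) - sin (of_int ?d * x)) / 2" for x
    by (simp add: cos_times_sin ring_distribs)
  have sin_d: "(\<Sum>j<n. sin (of_int ?d * (p j - \<phi>))) = 0"
    using sum_sin_points[OF d] by (cases "?k = ?k'") simp_all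
  have cos_d: "(\<Sum>j<n. cos (of_int ?d * (p j - \<phi>))) = 0" if "even i = even i'"
    using sum_cos_points[OF d] par that by blast
  note sums = sum.distrib sum_subtractf sum_divide_distrib[symmetric]
    sum_cos_points[OF s] sum_sin_points[OF s]
  show ?thesis
    using cos_d sin_d
    by (cases "even i"; cases "even i'")
      (simp_all only: trig_def if_True if_False cc ss sc cs sums, simp_all)
qed

end

section \<open>Comparison of the embedding with the curve\<close>

lemma rigid_motion_orthogonal:
  assumes Q: "Q \<in> carrier_mat m m" and orth: "transpose_mat Q * Q = 1\<^sub>m m"
  shows "rigid_motion m (\<lambda>x. Q *\<^sub>v x)"
proof -
  have QT: "transpose_mat Q \<in> carrier_mat m m" using Q by simp
  have orth': "Q * transpose_mat Q = 1\<^sub>m m"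
    by (rule mat_mult_left_right_inverse[OF QT Q orth])
  have "bij_betw (\<lambda>x. Q *\<^sub>v x) (carrier_vec m) (carrier_vec m)"
  proof (rule bij_betw_byWitness[where f' = "\<lambda>x. transpose_mat Q *\<^sub>v x"])
    show "\<forall>x\<in>carrier_vec m. transpose_mat Q *\<^sub>v (Q *\<^sub>v x) = x"
      using Q QT by (simp add: orth flip: assoc_mult_mat_vec[of _ m m _ m])
    show "\<forall>x\<in>carrier_vec m. Q *\<^sub>v (transpose_mat Q *\<^sub>v x) = x"
      using Q QT by (simp add: orth' flip: assoc_mult_mat_vec[of _ m m _ m])
  qed (use Q QT in \<open>auto intro: mult_mat_vec_carrier\<close>)
  moreover have "euclid_dist (Q *\<^sub>v x) (Q *\<^sub>v y) = euclid_dist x y"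
    if "x \<in> carrier_vec m" "y \<in> carrier_vec m" for x y
  proof -
    have xy: "x - y \<in> carrier_vec m" using that by simp
    have "Q *\<^sub>v x - Q *\<^sub>v y = Q *\<^sub>v (x - y)"
      using Q that by (simp add: mult_minus_distrib_mat_vec)
    moreover have "(Q *\<^sub>v (x - y)) \<bullet> (Q *\<^sub>v (x - y)) = (transpose_mat Q *\<^sub>v (Q *\<^sub>v (x - y))) \<bullet> (x - y)"
      using Q xy transpose_vec_mult_scalar[OF Q xy, of "Q *\<^sub>v (x - y)"] mult_mat_vec_carrier[OF Q xy] 
      by simp
    moreover have "transpose_mat Q *\<^sub>v (Q *\<^sub>v (x - y)) = x - y"
      using Q QT xy by (simp add: orth flip: assoc_mult_mat_vec[of _ m m _ m])
    ultimately show ?thesis by (simp add: euclid_dist_def)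
  qed
  ultimately show ?thesis by (simp add: rigid_motion_def)
qed

context evenly_spaced_points
begin

lemma sum_trig_sq:
  assumes "2 * coord_freq i < n"
  shows "(\<Sum>j<n. (trig \<phi> i j)\<^sup>2) = n / 2"
  using sum_cos_sq_points[OF _ assms, of \<phi>] odd_pos[OF odd_coord_freq[of i]]
  by (cases "even i") (simp_all add: trig_def)

text \<open>The span of cosine and sine of one frequency is invariant under phase shifts. This
  adapts all eigenvectors to the phase that the last column forces for odd \<open>m\<close>.\<close>

lemma gram_eigenvector_shifted:
  assumes "eigenvector gram v (mds_eigval n k)" and k: "odd k" "2 * k \<le> n"
  shows "\<exists>\<alpha> \<beta>. \<forall>j<n. v $ j = \<alpha> * cos (real k * (p j - \<phi>)) + \<beta> * sin (real k * (p j - \<phi>))"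
proof -
  obtain \<alpha> \<beta> where v: "\<And>j. j < n \<Longrightarrow> v $ j = \<alpha> * cos (real k * p j) + \<beta> * sin (real k * p j)"
    using gram_eigenspace[OF assms] by blast
  define C S where "C = cos (real k * \<phi>)" and "S = sin (real k * \<phi>)"
  have "v $ j = (\<alpha> * C + \<beta> * S) * cos (real k * (p j - \<phi>)) + (\<beta> * C - \<alpha> * S) * sin (real k * (p j - \<phi>))"
    if "j < n" for j
  proof -
    have "real k * p j = real k * (p j - \<phi>) + real k * \<phi>"
      by (simp add: algebra_simps)
    then have "cos (real k * p j) = cos (real k * (p j - \<phi>)) * C - sin (real k * (p j - \<phi>)) * S"
      "sin (real k * p j) = sin (real k * (p j - \<phi>)) * C + cos (real k * (p j - \<phi>)) * S"
      by (simp_all only: cos_add sin_add C_def S_def)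
    then show ?thesis unfolding v[OF that] by (simp only:) (simp add: ring_distribs)
  qed
  then show ?thesis by blast
qed

text \<open>The eigenvectors factor as \<open>\<Gamma> = E * Q\<close>, where \<open>E\<close>
  consists of normalised cosines and sines and \<open>Q\<close> is orthogonal and commutes with
  \<open>D\<close>. Hence \<open>\<Gamma> * D = (E * D) * Q\<close>, and \<open>Q\<close> carries
  the embedded points to the rows of \<open>E * D\<close>, which lie on the curve.\<close>

lemma mds_on_gamma_curve:
  assumes m: "m \<ge> 1" "m \<le> num_pos_eigvals gram"
    and mds: "classical_mds_embedding m (circle_dist_mat n p) P"
  shows "\<exists>f. rigid_motion m f \<and>
    f ` P \<subseteq> range (gamma_curve m (\<lambda>k. eigvec_scale n k * sqrt (mds_eigval n k)))"
proof -
  let ?ev = "\<lambda>i. mds_eigval n (coord_freq i)" and ?s = "\<lambda>i. eigvec_scale n (coord_freq i)"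
  have card: "m \<le> card {l. l < n \<and> mds_eigval n l > 0}"
    using m by (simp add: num_pos_eigvals_gram)
  note freq_le = coord_freq_bounds(1)[OF card] and freq_less = coord_freq_bounds(2)[OF card]
  obtain \<Gamma> where \<Gamma>: "\<Gamma> \<in> carrier_mat n m" "transpose_mat \<Gamma> * \<Gamma> = 1\<^sub>m m"
    and eig: "\<And>i. i < m \<Longrightarrow> eigenvector gram (col \<Gamma> i) (eigvals_desc gram ! i)"
    and P: "P = set (rows (\<Gamma> * mat_diag m (\<lambda>i. sqrt (eigvals_desc gram ! i))))"
    using mds carrier_matD[OF circle_dist_mat_carrier]
    by (auto simp: classical_mds_embedding_def Let_def)
  define D where "D = mat_diag m (\<lambda>i. sqrt (?ev i))"
  have D: "D \<in> carrier_mat m m" by (simp add: D_def)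
  have "mat_diag m (\<lambda>i. sqrt (eigvals_desc gram ! i)) = D"
    unfolding D_def mat_diag_def using m by (intro cong_mat) (auto simp: nth_eigvals_desc_gram)
  with P have P: "P = set (rows (\<Gamma> * D))" by simp
  have eig: "eigenvector gram (col \<Gamma> i) (?ev i)" if "i < m" for i
    using eig[OF that] m that by (simp add: nth_eigvals_desc_gram)
  have entry: "col \<Gamma> i $ r = \<Gamma> $$ (r, i)" if "i < m" "r < n" for i r
    using \<Gamma>(1) that by simp
  have norm: "(\<Sum>r<n. (\<Gamma> $$ (r, i))\<^sup>2) = 1" if "i < m" for i
    using arg_cong[OF \<Gamma>(2), of "\<lambda>M. M $$ (i, i)"] \<Gamma>(1) that
    by (simp add: scalar_prod_def power2_eq_square atLeast0LessThan)

  \<comment> \<open>For odd \<open>m\<close> the last column has no partner of its frequency with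
    which it could be rotated, so it dictates the phase of the whole curve. For even
    \<open>m\<close> any phase will do.\<close>
  have last: "\<exists>\<phi>. odd m \<longrightarrow> (\<forall>r<n. \<Gamma> $$ (r, m - 1) = ?s (m - 1) * trig \<phi> (m - 1) r)"
  proof (cases "odd m")
    case True
    have "m - 1 < m" using m by simp
    obtain \<alpha> \<beta> where "\<And>j. j < n \<Longrightarrow> \<Gamma> $$ (j, m - 1) =
        \<alpha> * cos (real (coord_freq (m - 1)) * p j) + \<beta> * sin (real (coord_freq (m - 1)) * p j)"
      using gram_eigenspace[OF eig odd_coord_freq freq_le] \<open>m - 1 < m\<close> entry by metis
    then have "\<exists>\<phi>. \<forall>j<n. \<Gamma> $$ (j, m - 1) = ?s (m - 1) * cos (real (coord_freq (m - 1)) * (p j - \<phi>))"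
      by (rule unit_eigenvector_eq_cos[rotated 2])
        (use norm freq_le \<open>m - 1 < m\<close> in \<open>auto intro: odd_pos\<close>)
    then show ?thesis using True by (simp add: trig_def)
  qed simp
  then obtain \<phi> where last: "\<And>r. odd m \<Longrightarrow> r < n \<Longrightarrow> \<Gamma> $$ (r, m - 1) = ?s (m - 1) * trig \<phi> (m - 1) r"
    by blast
  define E where "E = mat n m (\<lambda>(r, i). ?s i * trig \<phi> i r)"
  have E: "E \<in> carrier_mat n m" by (simp add: E_def)

  have ETE: "transpose_mat E * E = 1\<^sub>m m"
  proof (rule eq_matI)
    fix i i' assume "i < dim_row (1\<^sub>m m :: real mat)" "i' < dim_col (1\<^sub>m m :: real mat)"
    then have ii: "i < m" "i' < m" by simp_all
    have "(transpose_mat E * E) $$ (i, i') = (\<Sum>r<n. (?s i * trig \<phi> i r) * (?s i' * trig \<phi> i' r))"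
      using ii by (simp add: E_def scalar_prod_def atLeast0LessThan)
    also have "\<dots> = (if i = i' then 1 else 0)"
    proof (cases "i = i'")
      case False
      \<comment> \<open>Two different indices are not both the last one, so one of the bounds is
        strict.\<close>
      have "2 * coord_freq i < n \<or> 2 * coord_freq i' < n"
        using False freq_less[OF ii(1)] freq_less[OF ii(2)] ii by linarith
      then have "coord_freq i + coord_freq i' < n"
        using freq_le[OF ii(1)] freq_le[OF ii(2)] by linarith
      then have "(\<Sum>r<n. trig \<phi> i r * trig \<phi> i' r) = 0"
        by (rule sum_trig_orthogonal[OF False])
      moreover have "(\<Sum>r<n. (?s i * trig \<phi> i r) * (?s i' * trig \<phi> i' r)) =
          ?s i * ?s i' * (\<Sum>r<n. trig \<phi> i r * trig \<phi> i' r)"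
        unfolding sum_distrib_left by (intro sum.cong refl) simp
      ultimately show ?thesis using False by simp
    next
      case True
      show ?thesis
      proof (cases "odd i \<or> i + 1 < m")
        case less: True
        have "(\<Sum>r<n. (?s i * trig \<phi> i r) * (?s i' * trig \<phi> i' r)) = (?s i)\<^sup>2 * (\<Sum>r<n. (trig \<phi> i r)\<^sup>2)"
          unfolding sum_distrib_left True by (intro sum.cong refl) (simp add: power2_eq_square)
        also have "\<dots> = 2 / n * (n / 2)"
          using freq_less[OF ii(1) less] by (simp add: eigvec_scale_def sum_trig_sq)
        finally show ?thesis using True n_pos by simp
      next
        case False
        \<comment> \<open>The unpaired last column of \<open>E\<close> equals that of
          \<open>\<Gamma>\<close>, so it has norm 1 even if its frequency is
          \<open>n / 2\<close>.\<close>
        then have "m = Suc i" "even i" using ii by auto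
        then have "i = m - 1" "odd m" by auto
        then show ?thesis
          using norm[OF ii(1)] last True by (simp add: power2_eq_square)
      qed
    qed
    finally show "(transpose_mat E * E) $$ (i, i') = 1\<^sub>m m $$ (i, i')"
      using ii by simp
  qed (simp_all add: E_def)

  have "\<exists>q. (\<forall>i. coord_freq i \<noteq> coord_freq j \<longrightarrow> q i = 0) \<and>
      (\<forall>r<n. \<Gamma> $$ (r, j) = (\<Sum>i<m. E $$ (r, i) * q i))" if j: "j < m" for j
  proof (cases "odd j \<or> j + 1 < m")
    case False
    then have "m = Suc j" "even j" using j by auto
    then have "j = m - 1" "odd m" by auto
    then have "\<Gamma> $$ (r, j) = (\<Sum>i<m. E $$ (r, i) * of_bool (i = j))" if "r < n" for r
      using last j that by (simp add: E_def of_bool_def if_distrib[of "\<lambda>x. _ * x"] sum.delta cong: if_cong)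
    then show ?thesis by (intro exI[of _ "\<lambda>i. of_bool (i = j)"]) auto
  next
    case True
    \<comment> \<open>The even index of the pair containing \<open>j\<close>; its partner
      \<open>e + 1\<close> is below \<open>m\<close> because \<open>j\<close> is not an unpaired
      last index.\<close>
    define e where "e = 2 * (j div 2)"
    have e: "even e" "e + 1 < m" "coord_freq e = coord_freq j" "coord_freq (e + 1) = coord_freq j"
      using True j by (auto simp: e_def coord_freq_def elim!: evenE oddE)
    obtain \<alpha> \<beta> where ab: "\<And>r. r < n \<Longrightarrow> \<Gamma> $$ (r, j) =
        \<alpha> * cos (real (coord_freq j) * (p r - \<phi>)) + \<beta> * sin (real (coord_freq j) * (p r - \<phi>))"
      using gram_eigenvector_shifted[OF eig[OF j] odd_coord_freq freq_le[OF j], of \<phi>] entry[OF j] by metis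
    have s: "?s j \<noteq> 0" using n_pos by (simp add: eigvec_scale_def)
    define q where "q i = (if i = e then \<alpha> / ?s j else if i = e + 1 then \<beta> / ?s j else 0)" for i
    have "\<Gamma> $$ (r, j) = (\<Sum>i<m. E $$ (r, i) * q i)" if r: "r < n" for r
    proof -
      have "(\<Sum>i<m. E $$ (r, i) * q i) = (\<Sum>i\<in>{e, e + 1}. E $$ (r, i) * q i)"
        using e by (intro sum.mono_neutral_right) (auto simp: q_def)
      also have "\<dots> = \<Gamma> $$ (r, j)"
        using e s r by (simp add: E_def q_def trig_def ab)
      finally show ?thesis by simp
    qed
    then show ?thesis
      using e by (intro exI[of _ q]) (auto simp: q_def)
  qed
  then obtain q where q0: "\<And>i j. j < m \<Longrightarrow> coord_freq i \<noteq> coord_freq j \<Longrightarrow> q j i = 0"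
    and q: "\<And>r j. j < m \<Longrightarrow> r < n \<Longrightarrow> \<Gamma> $$ (r, j) = (\<Sum>i<m. E $$ (r, i) * q j i)"
    by metis
  define Q where "Q = mat m m (\<lambda>(i, j). q j i)"
  have Q: "Q \<in> carrier_mat m m" by (simp add: Q_def)
  have \<Gamma>_eq: "\<Gamma> = E * Q"
    using \<Gamma>(1) E by (intro eq_matI) (auto simp: q Q_def scalar_prod_def atLeast0LessThan)
  \<comment> \<open>\<open>Q\<close> mixes only indices of equal frequency, on which
    \<open>D\<close> has equal entries.\<close>
  have QD: "Q * D = D * Q"
    unfolding D_def mat_diag_mult_right[OF Q] mat_diag_mult_left[OF Q]
  proof (rule cong_mat)
    fix i j assume "i < m" "j < m"
    then show "(\<lambda>(i, j). Q $$ (i, j) * sqrt (?ev j)) (i, j) = (\<lambda>(i, j). sqrt (?ev i) * Q $$ (i, j)) (i, j)"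
      by (cases "coord_freq i = coord_freq j") (simp_all add: Q_def q0)
  qed simp_all
  have T: "transpose_mat Q \<in> carrier_mat m m" "transpose_mat E \<in> carrier_mat m n"
    using Q E by simp_all
  have "transpose_mat Q * Q = transpose_mat Q * ((transpose_mat E * E) * Q)"
    using Q by (simp add: ETE)
  also have "\<dots> = transpose_mat \<Gamma> * \<Gamma>"
    using Q E T unfolding \<Gamma>_eq transpose_mult[OF E Q]
    by (simp add: assoc_mult_mat[of _ m n _ m _ m] assoc_mult_mat[of _ m m _ n _ m])
  finally have orth: "transpose_mat Q * Q = 1\<^sub>m m" using \<Gamma>(2) by simp
  have orth': "Q * transpose_mat Q = 1\<^sub>m m"
    by (rule mat_mult_left_right_inverse[OF T(1) Q orth])

  have "Q *\<^sub>v x \<in> range (gamma_curve m (\<lambda>k. eigvec_scale n k * sqrt (mds_eigval n k)))" if "x \<in> P" for x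
  proof -
    have ED: "E * D \<in> carrier_mat n m" using E D by simp
    have GD: "\<Gamma> * D = E * D * Q"
      using E D Q by (simp add: \<Gamma>_eq QD assoc_mult_mat[of _ n m _ m _ m])
    have "P = row (\<Gamma> * D) ` {..<n}"
      using P \<Gamma>(1) by (simp add: rows_def atLeast0LessThan)
    then obtain r where r: "r < n" and x: "x = row (\<Gamma> * D) r"
      using \<open>x \<in> P\<close> by blast
    define y where "y = row (E * D) r"
    have y: "y \<in> carrier_vec m" unfolding y_def by (rule row_carrier_vec[OF r ED])
    have "x = transpose_mat Q *\<^sub>v y"
    proof (rule eq_vecI)
      fix i assume "i < dim_vec (transpose_mat Q *\<^sub>v y)"
      then have i: "i < m" using Q by simp
      show "x $ i = (transpose_mat Q *\<^sub>v y) $ i"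
        using i r ED Q by (simp add: x y_def GD comm_scalar_prod[of _ m])
    qed (use Q ED r in \<open>simp add: x GD\<close>)
    then have "Q *\<^sub>v x = y"
      using Q T y by (simp add: orth' flip: assoc_mult_mat_vec[of _ m m _ m])
    also have "y = gamma_curve m (\<lambda>k. eigvec_scale n k * sqrt (mds_eigval n k)) (p r - \<phi>)"
      unfolding y_def D_def mat_diag_mult_right[OF E]
      using r by (intro eq_vecI) (auto simp: gamma_curve_def E_def trig_def coord_freq_def)
    finally show ?thesis by simp
  qed
  then show ?thesis
    using rigid_motion_orthogonal[OF Q orth] by blast
qed

end

theorem proposition7p2p6:
  fixes m :: nat
  assumes "m \<ge> 1"
  shows "\<exists>a :: nat \<Rightarrow> nat \<Rightarrow> real.
    (\<forall>j. odd j \<longrightarrow> (\<lambda>n. a j n) \<longlonglongrightarrow> sqrt 2 / real j) \<and>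
    (\<forall>n p P. n \<ge> 1 \<longrightarrow> evenly_spaced n p \<longrightarrow>
       m \<le> num_pos_eigvals (mds_gram (circle_dist_mat n p)) \<longrightarrow>
       classical_mds_embedding m (circle_dist_mat n p) P \<longrightarrow>
       (\<exists>f. rigid_motion m f \<and> f ` P \<subseteq> range (gamma_curve m (\<lambda>j. a j n))))"
\<comment> \<open>The radius is the amplitude of a unit eigenvector times the square root of its
  eigenvalue. It depends only on \<open>n\<close> and the frequency, so it suits all point lists and
  all embeddings.\<close>
proof (intro exI[of _ "\<lambda>j n. eigvec_scale n j * sqrt (mds_eigval n j)"] conjI allI impI)
  fix j :: nat assume "odd j"
  then show "(\<lambda>n. eigvec_scale n j * sqrt (mds_eigval n j)) \<longlonglongrightarrow> sqrt 2 / real j"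
    by (rule mds_radius_tendsto)
next
  fix n p P
  assume n: "n \<ge> 1" "evenly_spaced n p"
    and mds: "m \<le> num_pos_eigvals (mds_gram (circle_dist_mat n p))"
      "classical_mds_embedding m (circle_dist_mat n p) P"
  obtain c \<sigma> where "evenly_spaced_points n p c \<sigma>"
    using evenly_spaced_imp_points[of n p] n by auto
  then interpret evenly_spaced_points n p c \<sigma> .
  show "\<exists>f. rigid_motion m f \<and>
      f ` P \<subseteq> range (gamma_curve m (\<lambda>j. eigvec_scale n j * sqrt (mds_eigval n j)))"
    by (rule mds_on_gamma_curve[OF assms mds])
qed

end
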